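(* Consider the Curie--Weiss measures $\mu_N$ on $\{-1,+1\}^N$ with inverse temperature $\beta=1$ and external field $h=0$. Let $k=k(N)$ be positive integers with $k(N)\le N$ and $k(N)\to\infty$ as $N\to\infty$. Let $\mu_N^{(k)}$ be the law of $(\sigma_1,\dots,\sigma_k)$ under $\mu_N$, and let $\pi=\frac12\delta_{-1}+\frac12\delta_{+1}$. Then: (1) If $k(N)/N^{1/2}\to 0$, then $d_{\mathrm{TV}}\big(\mu_N^{(k(N))},\pi^{\otimes k(N)}\big)\to 0$ as $N\to\infty$. (2) If $k(N)/N^{1/2}\to\alpha\in(0,\infty)$, then the limit $$u(\alpha):=\lim_{N\to\infty} d_{\mathrm{TV}}\big(\mu_N^{(k(N))},\pi^{\otimes k(N)}\big)$$ exists and satisfies $0<u(\alpha)<1$. Explicitly, $$u(\alpha)=d_{\mathrm{TV}}\big(\nu_\alpha,\mathcal N(0,1/4)\big),$$ where $\nu_\alpha$ is the law of $Z+\sqrt{\alpha}\,X$, with $Z\sim\mathcal N(0,1/4)$ and $X$ independent real random variables, and $X$ having density $$f_X(x)=\frac{\exp\left(-\frac43x^4\right)}{\int_{\mathbb R}\exp\left(-\frac43y^4\right)dy},\qquad x\in\mathbb R.$$ (3) If $k(N)/N^{1/2}\to\infty$, then $d_{\mathrm{TV}}\big(\mu_N^{(k(N))},\pi^{\otimes k(N)}\big)\to 1$ as $N\to\infty$.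
   Context: For $\beta=1$ and $h=0$ the Curie--Weiss (Gibbs) measure on $\{-1,+1\}^N$ is the probability measure $$\mu_N(\sigma)=\frac1{Z_N}\exp\left(\frac1{2N}\sum_{i,j=1}^N\sigma_i\sigma_j\right),\qquad \sigma=(\sigma_i)_{i=1}^N\in\{-1,+1\}^N,$$ where $Z_N$ is the normalizing constant. Total variation distance is normalized so that its maximal value is $1$: $d_{\mathrm{TV}}(P,Q)=\sup_A|P(A)-Q(A)|$. $\mathcal N(0,1/4)$ is the centered Gaussian law with variance $1/4$, and $\pi^{\otimes k}$ is the $k$-fold product measure of $\pi$ on $\{-1,+1\}^k$. *)

theory Defs
  imports "HOL-Probability.Probability"
begin

text \<open>
  Total variation distance, normalized to have maximal value 1. It is meant for probability
  measures with the same measurable sets, for which the supremum is over a bounded set of reals.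
\<close>

definition tv_dist :: "'a measure \<Rightarrow> 'a measure \<Rightarrow> real" where
  "tv_dist P Q = (SUP A\<in>sets P. \<bar>measure P A - measure Q A\<bar>)"

text \<open>
  Spin configurations are extensional functions on \<open>{1..N}\<close>.
\<close>

definition spin_configs :: "nat \<Rightarrow> (nat \<Rightarrow> real) set" where
  "spin_configs N = {1..N} \<rightarrow>\<^sub>E {-1, 1}"

definition cw_weight :: "nat \<Rightarrow> (nat \<Rightarrow> real) \<Rightarrow> real" where
  "cw_weight N \<sigma> = exp (1 / (2 * real N) * (\<Sum>i=1..N. \<Sum>j=1..N. \<sigma> i * \<sigma> j))"

definition cw_partition :: "nat \<Rightarrow> real" where
  "cw_partition N = (\<Sum>\<sigma>\<in>spin_configs N. cw_weight N \<sigma>)"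

definition curie_weiss :: "nat \<Rightarrow> (nat \<Rightarrow> real) measure" where
  "curie_weiss N =
     point_measure (spin_configs N) (\<lambda>\<sigma>. ennreal (cw_weight N \<sigma> / cw_partition N))"

definition cw_marginal :: "nat \<Rightarrow> nat \<Rightarrow> (nat \<Rightarrow> real) measure" where
  "cw_marginal N k =
     distr (curie_weiss N) (\<Pi>\<^sub>M i\<in>{1..k}. count_space {-1, 1}) (\<lambda>\<sigma>. restrict \<sigma> {1..k})"

definition fair_spin :: "real measure" where
  "fair_spin = point_measure {-1, 1} (\<lambda>_. 1 / 2)"

definition fair_spins :: "nat \<Rightarrow> (nat \<Rightarrow> real) measure" where
  "fair_spins k = (\<Pi>\<^sub>M i\<in>{1..k}. fair_spin)"

text \<open>
  The second parameter of \<^const>\<open>normal_density\<close> is the standard deviation,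
  that of \<open>normal_law\<close> the variance.
\<close>

definition normal_law :: "real \<Rightarrow> real \<Rightarrow> real measure" where
  "normal_law m v = density lborel (\<lambda>x. ennreal (normal_density m (sqrt v) x))"

definition quartic_density :: "real \<Rightarrow> real" where
  "quartic_density x = exp (- (4 / 3) * x ^ 4) / (\<integral>y. exp (- (4 / 3) * y ^ 4) \<partial>lborel)"

definition quartic_law :: "real measure" where
  "quartic_law = density lborel (\<lambda>x. ennreal (quartic_density x))"

definition nu :: "real \<Rightarrow> real measure" where
  "nu \<alpha> = distr (normal_law 0 (1 / 4) \<Otimes>\<^sub>M quartic_law) borel (\<lambda>(z, x). z + sqrt \<alpha> * x)"

text \<open>
  Independence of \<open>Z\<close> and \<open>X\<close> is encoded in \<open>nu\<close> by the product measure; any independent pair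
  with these marginals gives the same law.
\<close>

lemma nu_eq_distr_indep:
  assumes "prob_space M" and "prob_space.indep_var M borel Z borel X"
    and "distr M borel Z = normal_law 0 (1 / 4)" and "distr M borel X = quartic_law"
  shows "distr M borel (\<lambda>\<omega>. Z \<omega> + sqrt \<alpha> * X \<omega>) = nu \<alpha>"
proof -
  interpret prob_space M by fact
  have [measurable]: "Z \<in> borel_measurable M" "X \<in> borel_measurable M"
    using indep_var_rv1[OF assms(2)] indep_var_rv2[OF assms(2)] by auto
  have "normal_law 0 (1 / 4) \<Otimes>\<^sub>M quartic_law = distr M (borel \<Otimes>\<^sub>M borel) (\<lambda>\<omega>. (Z \<omega>, X \<omega>))"
    using assms(2-4) by (simp add: indep_var_distribution_eq)
  then show ?thesis
    by (simp add: nu_def distr_distr comp_def)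
qed

lemma prob_space_curie_weiss: "prob_space (curie_weiss N)"
proof
  have fin: "finite (spin_configs N)"
    by (simp add: spin_configs_def finite_PiE)
  have ne: "spin_configs N \<noteq> {}"
    by (simp add: spin_configs_def PiE_eq_empty_iff)
  have pos: "cw_partition N > 0"
    unfolding cw_partition_def using fin ne by (intro sum_pos) (auto simp: cw_weight_def)
  have "emeasure (curie_weiss N) (space (curie_weiss N))
      = (\<Sum>\<sigma>\<in>spin_configs N. ennreal (cw_weight N \<sigma> / cw_partition N))"
    using fin by (simp add: curie_weiss_def space_point_measure emeasure_point_measure_finite)
  also have "\<dots> = ennreal (\<Sum>\<sigma>\<in>spin_configs N. cw_weight N \<sigma> / cw_partition N)"
    using pos by (intro sum_ennreal) (auto simp: cw_weight_def)
  also have "(\<Sum>\<sigma>\<in>spin_configs N. cw_weight N \<sigma> / cw_partition N) = 1"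
    using pos by (simp add: sum_divide_distrib[symmetric] cw_partition_def[symmetric])
  finally show "emeasure (curie_weiss N) (space (curie_weiss N)) = 1" by simp
qed

lemma sets_cw_marginal_eq: "sets (cw_marginal N k) = sets (fair_spins k)"
  unfolding cw_marginal_def fair_spins_def fair_spin_def
  by (simp, intro sets_PiM_cong) (auto simp: sets_point_measure)

end

theory Submission
  imports Defs "HOL-Analysis.Infinite_Set_Sum" "HOL-Real_Asymp.Real_Asymp"
begin

text \<open>
  The weight \<open>exp (S\<^sup>2 / (2 * N))\<close> with \<open>S = \<Sum>i. \<sigma> i\<close> is a Gaussian integral of \<open>exp (s * S)\<close> over a field
  \<open>s\<close> (\<open>cw_weight_field_representation\<close>), and for fixed \<open>s\<close> the spins are independent. Summing over
  the spins outside \<open>{1..k}\<close> gives the density of the marginal with respect to fair spins as a quotient of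
  integrals over \<open>s\<close>, which depends on the spins only through \<open>w = (\<Sum>i\<le>k. \<sigma> i) / sqrt k\<close>
  (\<open>cw_marginal_eq_density\<close>). The field has weight \<open>exp (- N * (s\<^sup>2 / 2 - ln (cosh s)))\<close>. The bracket
  vanishes to fourth order at 0, so \<open>s\<close> lives on the scale \<open>N\<^bsup>-1/4\<^esup>\<close>, and \<open>y = N\<^bsup>1/4\<^esup> * s\<close> has limiting
  weight \<open>exp (- y ^ 4 / 12)\<close>.

  In terms of \<open>y\<close>, a spin configuration with normalized sum \<open>w\<close> has likelihood ratio about
  \<open>exp (c * y * w - c\<^sup>2 * y\<^sup>2 / 2)\<close> with \<open>c\<^sup>2 = k / sqrt N\<close>. By dominated convergence the density tends
  to the mixture of these ratios, \<open>limit_ratio \<alpha> w\<close>, when \<open>k / sqrt N\<close> tends to \<open>\<alpha>\<close>, and to 0 when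
  \<open>k / sqrt N\<close> tends to infinity. The convergence is continuous, that is, along every convergent
  sequence of arguments \<open>w\<close>. The one Gaussian majorant of \<open>field_exponent_le\<close> covers all cases.

  The total variation distance to fair spins is the expectation of \<open>max 0 (1 - density)\<close>
  (\<open>tv_dist_density\<close>), a bounded functional. Under fair spins \<open>w\<close> is asymptotically standard normal
  (\<open>spin_sum_central_limit\<close>), so Skorohod's representation and bounded convergence give the limit
  \<open>\<integral>w. max 0 (1 - L w)\<close> under the standard normal distribution, where \<open>L\<close> is the limiting density
  (\<open>tv_dist_cw_marginal_tendsto\<close>). For \<open>\<alpha> = 0\<close> the limit density is constantly 1 and the distance tends to
  0; when \<open>k / sqrt N\<close> tends to infinity it is 0 and the distance tends to 1. For \<open>\<alpha> > 0\<close>, \<open>limit_ratio \<alpha>\<close> is,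
  after halving all variables, the density of \<open>nu \<alpha>\<close> with respect to the centred Gaussian of variance
  \<open>1 / 4\<close> (\<open>nu_eq_density\<close>), so the same integral is the distance between these two laws.
\<close>

section \<open>Gaussian integrals and the gap between a parabola and the logarithm of cosh\<close>

text \<open>
  Read from right to left, this is the Gaussian linearization (Hubbard--Stratonovich transformation)
  that turns the square of the total spin in the Gibbs weight into a mixture of linear terms. With
  \<open>b = 0\<close> it supplies the integrable majorant for the integrals over the field.
\<close>

lemma has_bochner_integral_gaussian_shift:
  fixes a b :: real
  assumes "0 < a"
  shows "has_bochner_integral lborel (\<lambda>y. exp (b * y - a * y\<^sup>2 / 2))
           (sqrt (2 * pi / a) * exp (b\<^sup>2 / (2 * a)))"
proof -
  have s: "0 < 1 / sqrt a" using assms by simp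
  have eq: "exp (b * y - a * y\<^sup>2 / 2) =
      (sqrt (2 * pi / a) * exp (b\<^sup>2 / (2 * a))) * normal_density (b / a) (1 / sqrt a) y" for y
  proof -
    have "b * y - a * y\<^sup>2 / 2 = b\<^sup>2 / (2 * a) + - (y - b / a)\<^sup>2 / (2 * (1 / sqrt a)\<^sup>2)"
      using assms by (simp add: power2_diff power_divide) (simp add: field_simps power2_eq_square)
    then show ?thesis
      using assms by (simp add: normal_density_def exp_diff exp_minus power_divide) (simp add: field_simps)
  qed
  have "has_bochner_integral lborel (normal_density (b / a) (1 / sqrt a)) 1"
    using s by (simp add: has_bochner_integral_iff integrable_normal_density integral_normal_density)
  then have "has_bochner_integral lborel
      (\<lambda>y. (sqrt (2 * pi / a) * exp (b\<^sup>2 / (2 * a))) * normal_density (b / a) (1 / sqrt a) y)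
      ((sqrt (2 * pi / a) * exp (b\<^sup>2 / (2 * a))) * 1)"
    by (intro has_bochner_integral_mult_right)
  then show ?thesis
    unfolding eq by simp
qed

text \<open>
  Comparing power series: the coefficients of \<open>exp (x\<^sup>2 / 2)\<close> dominate those of \<open>cosh x\<close> because
  \<open>2 ^ m * fact m \<le> fact (2 * m)\<close>, they agree in degrees 0 and 2, and the difference in degree 4
  is \<open>1 / 8 - 1 / 24 = 1 / 12\<close>.
\<close>

lemma exp_half_square_minus_cosh_ge:
  fixes x :: real
  shows "x ^ 4 / 12 \<le> exp (x\<^sup>2 / 2) - cosh x"
proof -
  have c: "(\<lambda>m. x ^ (2 * m) / fact (2 * m)) sums cosh x"
  proof -
    have "(\<lambda>m. if even (2 * m) then x ^ (2 * m) /\<^sub>R fact (2 * m) else 0) sums cosh x"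
      using cosh_converges[of x]
      by (subst sums_mono_reindex[of "\<lambda>m. 2 * m"]) (auto simp: strict_mono_def elim!: oddE evenE)
    then show ?thesis by (simp add: divide_inverse mult.commute)
  qed
  have "(\<lambda>m. z ^ m / fact m) sums exp z" for z :: real
    using exp_converges[of z] by (simp add: divide_inverse mult.commute)
  then have e: "(\<lambda>m. (x\<^sup>2 / 2) ^ m / fact m) sums exp (x\<^sup>2 / 2)" .
  have fact_le: "2 ^ m * fact m \<le> (fact (2 * m) :: real)" for m
  proof (induction m)
    case (Suc m)
    have "2 ^ Suc m * fact (Suc m) = (2 * real (Suc m)) * (2 ^ m * fact m)" by simp
    also have "\<dots> \<le> (2 * real (Suc m)) * (real (2 * m + 1) * fact (2 * m))"
    proof (intro mult_left_mono)
      have "1 * fact (2 * m) \<le> real (2 * m + 1) * fact (2 * m)"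
        by (intro mult_right_mono) auto
      with Suc show "2 ^ m * fact m \<le> real (2 * m + 1) * fact (2 * m)" by linarith
    qed simp
    also have "\<dots> = fact (2 * Suc m)" by (simp add: algebra_simps)
    finally show ?case .
  qed simp
  define d where "d m = (x\<^sup>2 / 2) ^ m / fact m - x ^ (2 * m) / fact (2 * m)" for m
  have d: "d sums (exp (x\<^sup>2 / 2) - cosh x)"
    unfolding d_def using e c by (rule sums_diff)
  have "d m \<ge> 0" for m
  proof -
    have "x ^ (2 * m) / fact (2 * m) \<le> x ^ (2 * m) / (2 ^ m * fact m)"
      using fact_le[of m] by (intro divide_left_mono) (auto simp: zero_le_even_power)
    then show ?thesis by (simp add: d_def power_divide power_mult)
  qed
  with d have "sum d {2} \<le> exp (x\<^sup>2 / 2) - cosh x"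
    using sum_le_suminf[of d "{2}"] by (auto simp: sums_iff)
  moreover have "d 2 = x ^ 4 / 12"
    by (simp add: d_def fact_numeral power_divide power_mult[symmetric])
  ultimately show ?thesis by simp
qed

text \<open>
  At inverse temperature 1 the field at each spin is governed by the potential
  \<open>s\<^sup>2 / 2 - ln (cosh s)\<close>. Criticality is the statement that its quadratic part vanishes at 0.
\<close>

definition log_cosh_gap :: "real \<Rightarrow> real" where
  "log_cosh_gap s = s\<^sup>2 / 2 - ln (cosh s)"

lemma continuous_on_log_cosh_gap: "continuous_on A log_cosh_gap"
  unfolding log_cosh_gap_def
  by (intro continuous_intros) auto

lemma measurable_log_cosh_gap [measurable]: "log_cosh_gap \<in> borel_measurable borel"
  by (intro borel_measurable_continuous_onI continuous_on_log_cosh_gap)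

lemma log_cosh_gap_0 [simp]: "log_cosh_gap 0 = 0"
  by (simp add: log_cosh_gap_def)

lemma log_cosh_gap_le: "log_cosh_gap s \<le> s\<^sup>2 / 2"
  using cosh_real_ge_1[of s] by (simp add: log_cosh_gap_def)

text \<open>
  From \<open>- ln r \<ge> 1 - r\<close> with \<open>r = cosh s * exp (- s\<^sup>2 / 2)\<close>. The bound has the right order only
  for bounded \<open>s\<close>; for large \<open>s\<close> the quadratic bound \<open>log_cosh_gap_ge_square\<close> takes over.
\<close>

lemma log_cosh_gap_ge_quartic: "s ^ 4 / 12 * exp (- s\<^sup>2 / 2) \<le> log_cosh_gap s"
proof -
  let ?r = "cosh s * exp (- s\<^sup>2 / 2)"
  have "s ^ 4 / 12 * exp (- s\<^sup>2 / 2) \<le> (exp (s\<^sup>2 / 2) - cosh s) * exp (- s\<^sup>2 / 2)"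
    by (intro mult_right_mono exp_half_square_minus_cosh_ge) auto
  also have "\<dots> = 1 - ?r"
    by (simp add: algebra_simps exp_add[symmetric])
  also have "\<dots> \<le> - ln ?r"
    using ln_le_minus_one[of ?r] by simp
  also have "\<dots> = log_cosh_gap s"
    by (simp add: ln_mult log_cosh_gap_def)
  finally show ?thesis .
qed

lemma log_cosh_gap_nonneg: "0 \<le> log_cosh_gap s"
proof -
  have "0 \<le> s ^ 4 / 12 * exp (- s\<^sup>2 / 2)" by (simp add: zero_le_even_power)
  with log_cosh_gap_ge_quartic[of s] show ?thesis by linarith
qed

lemma log_cosh_gap_ge_square: "s\<^sup>2 / 2 - \<bar>s\<bar> \<le> log_cosh_gap s"
proof -
  have "exp s \<le> exp \<bar>s\<bar>" "exp (- s) \<le> exp \<bar>s\<bar>" by simp_all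
  then have "exp s + exp (- s) \<le> exp \<bar>s\<bar> + exp \<bar>s\<bar>" by (rule add_mono)
  then have "cosh s \<le> exp \<bar>s\<bar>"
    by (simp add: cosh_field_def)
  then have "ln (cosh s) \<le> ln (exp \<bar>s\<bar>)"
    by (intro ln_mono) auto
  then show ?thesis by (simp add: log_cosh_gap_def)
qed

text \<open>
  The quartic lower bound is used on \<open>\<bar>s\<bar> \<le> 3\<close>, where \<open>exp (- s\<^sup>2 / 2) \<ge> exp (- 9 / 2)\<close>.
\<close>

definition tail_const :: real where
  "tail_const = exp (- 9 / 2) / 12"

lemma tail_const_pos: "0 < tail_const" and tail_const_le: "tail_const \<le> 1 / 12"
  by (auto simp: tail_const_def)

lemma quartic_ge_quadratic: "2 * y\<^sup>2 - 1 \<le> (y :: real) ^ 4"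
proof -
  have "0 \<le> (y\<^sup>2 - 1)\<^sup>2" by simp
  then show ?thesis by (simp add: power2_diff flip: power_mult)
qed

text \<open>
  The total potential at the critical scale \<open>s = y / N\<^bsup>1/4\<^esup>\<close> grows at least quadratically in \<open>y\<close>,
  uniformly in \<open>N\<close>. A quadratic bound is weaker than the true quartic growth for moderate \<open>y\<close>, but
  it holds for both ranges of \<open>s\<close> at once and makes the majorant a Gaussian.
\<close>

lemma scaled_log_cosh_gap_ge:
  assumes "N \<ge> (1::nat)"
  shows "tail_const * (2 * y\<^sup>2 - 1) \<le> real N * log_cosh_gap (y / sqrt (sqrt (real N)))"
proof -
  let ?s = "y / sqrt (sqrt (real N))"
  have s2: "?s\<^sup>2 = y\<^sup>2 / sqrt (real N)"
    using assms by (simp add: power_divide)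
  have s4: "?s ^ 4 = y ^ 4 / real N"
  proof -
    have "?s ^ 4 = (?s\<^sup>2)\<^sup>2" by (simp flip: power_mult)
    also have "\<dots> = y ^ 4 / real N"
      unfolding s2 using assms by (simp add: power_divide flip: power_mult)
    finally show ?thesis .
  qed
  show ?thesis
  proof (cases "\<bar>?s\<bar> \<le> 3")
    case True
    then have "?s\<^sup>2 \<le> 3\<^sup>2" by (metis abs_ge_zero power2_abs power_mono)
    then have "exp (- 9 / 2) \<le> exp (- ?s\<^sup>2 / 2)" by simp
    then have "?s ^ 4 / 12 * exp (- 9 / 2) \<le> ?s ^ 4 / 12 * exp (- ?s\<^sup>2 / 2)"
      by (intro mult_left_mono) (auto simp: zero_le_even_power)
    with log_cosh_gap_ge_quartic[of ?s] have "?s ^ 4 / 12 * exp (- 9 / 2) \<le> log_cosh_gap ?s"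
      by linarith
    then have "real N * (?s ^ 4 / 12 * exp (- 9 / 2)) \<le> real N * log_cosh_gap ?s"
      by (intro mult_left_mono) auto
    moreover have "real N * (?s ^ 4 / 12 * exp (- 9 / 2)) = tail_const * y ^ 4"
      unfolding s4 tail_const_def using assms by simp
    moreover have "tail_const * (2 * y\<^sup>2 - 1) \<le> tail_const * y ^ 4"
      using tail_const_pos quartic_ge_quadratic[of y] by (intro mult_left_mono) auto
    ultimately show ?thesis by linarith
  next
    case False
    have "\<bar>?s\<bar> * 3 \<le> \<bar>?s\<bar> * \<bar>?s\<bar>"
      using False by (intro mult_left_mono) auto
    then have "?s\<^sup>2 / 6 \<le> ?s\<^sup>2 / 2 - \<bar>?s\<bar>"
      by (simp add: power2_eq_square)
    with log_cosh_gap_ge_square[of ?s] have "?s\<^sup>2 / 6 \<le> log_cosh_gap ?s" by linarith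
    then have "real N * (?s\<^sup>2 / 6) \<le> real N * log_cosh_gap ?s"
      by (intro mult_left_mono) auto
    moreover have "real N * (?s\<^sup>2 / 6) = sqrt (real N) * (y\<^sup>2 / 6)"
      unfolding s2 using assms by (simp add: field_simps flip: real_sqrt_mult)
    moreover have "1 * (y\<^sup>2 / 6) \<le> sqrt (real N) * (y\<^sup>2 / 6)"
      using assms by (intro mult_right_mono) auto
    moreover have "tail_const * (2 * y\<^sup>2) \<le> 1 / 12 * (2 * y\<^sup>2)"
      using tail_const_le by (intro mult_right_mono) auto
    moreover have "tail_const * (2 * y\<^sup>2 - 1) \<le> tail_const * (2 * y\<^sup>2)"
      using tail_const_pos by (intro mult_left_mono) auto
    ultimately show ?thesis by linarith
  qed
qed

text \<open>
  The fourth-order behaviour of the potential at 0 is the origin of the quartic law.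
\<close>

lemma scaled_log_cosh_gap_tendsto:
  "(\<lambda>N. real N * log_cosh_gap (y / sqrt (sqrt (real N)))) \<longlonglongrightarrow> y ^ 4 / 12"
proof (cases "y = 0")
  case True
  then show ?thesis by simp
next
  case False
  have lim: "((\<lambda>s::real. (s\<^sup>2 / 2 - ln (cosh s)) / s ^ 4) \<longlongrightarrow> 1 / 12) (at 0)"
    by real_asymp
  have "filterlim (\<lambda>N. y / sqrt (sqrt (real N))) (at 0) sequentially"
  proof (subst filterlim_at, intro conjI)
    show "\<forall>\<^sub>F N in sequentially. y / sqrt (sqrt (real N)) \<in> UNIV \<and> y / sqrt (sqrt (real N)) \<noteq> 0"
      using eventually_ge_at_top[of 1] by eventually_elim (use False in auto)
    show "(\<lambda>N. y / sqrt (sqrt (real N))) \<longlonglongrightarrow> 0"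
      by real_asymp
  qed
  from filterlim_compose[OF lim this]
  have "(\<lambda>N. log_cosh_gap (y / sqrt (sqrt (real N))) / (y / sqrt (sqrt (real N))) ^ 4) \<longlonglongrightarrow> 1 / 12"
    by (simp add: log_cosh_gap_def)
  from tendsto_mult[OF tendsto_const[of "y ^ 4"] this]
  have *: "(\<lambda>N. y ^ 4 * (log_cosh_gap (y / sqrt (sqrt (real N))) / (y / sqrt (sqrt (real N))) ^ 4))
          \<longlonglongrightarrow> y ^ 4 / 12" by simp
  show ?thesis
  proof (rule Lim_transform_eventually[OF *])
    show "\<forall>\<^sub>F N in sequentially. y ^ 4 * (log_cosh_gap (y / sqrt (sqrt (real N))) / (y / sqrt (sqrt (real N))) ^ 4)
        = real N * log_cosh_gap (y / sqrt (sqrt (real N)))"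
      using eventually_ge_at_top[of 1]
    proof eventually_elim
      case (elim N)
      have "sqrt (sqrt (real N)) ^ 4 = ((sqrt (sqrt (real N)))\<^sup>2)\<^sup>2"
        by (simp only: power_mult[symmetric]) simp
      also have "\<dots> = real N" by simp
      finally show ?case using False elim by (simp add: power_divide)
    qed
  qed
qed

section \<open>The density of the marginal as an integral over the field\<close>

text \<open>
  Conditionally on the field \<open>s = y / N\<^bsup>1/4\<^esup>\<close> the spins are independent and take the value
  \<open>x\<close> with probability \<open>exp (s * x) / (2 * cosh s)\<close>. Summing over \<open>N - k\<close> of them leaves, up to the
  factor \<open>2 ^ (N - k)\<close>, the integrand
  \<open>exp (s * S) * cosh s ^ (N - k) * exp (- N * s\<^sup>2 / 2)\<close>, where \<open>S = sqrt k * w\<close> is the sum of the other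
  \<open>k\<close>. The exponent below is its logarithm, arranged so that \<open>N\<close> and \<open>k\<close> enter through \<open>k / sqrt N\<close>
  and the potential only.
\<close>

definition field_exponent :: "nat \<Rightarrow> nat \<Rightarrow> real \<Rightarrow> real \<Rightarrow> real" where
  "field_exponent N k w y =
     sqrt (real k / sqrt (real N)) * y * w - real k / sqrt (real N) * y\<^sup>2 / 2
     - (real N - real k) * log_cosh_gap (y / sqrt (sqrt (real N)))"

definition field_integral :: "nat \<Rightarrow> nat \<Rightarrow> real \<Rightarrow> real" where
  "field_integral N k w = (\<integral>y. exp (field_exponent N k w y) \<partial>lborel)"

lemma measurable_field_exponent [measurable]:
  "(\<lambda>(w, y). field_exponent N k w y) \<in> borel_measurable (borel \<Otimes>\<^sub>M borel)"
  unfolding field_exponent_def split_beta by measurable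

lemma measurable_field_integral [measurable]:
  "field_integral N k \<in> borel_measurable borel"
  unfolding field_integral_def by measurable

lemma linear_minus_square_le:
  fixes c y w :: real
  shows "c * y * w - c\<^sup>2 * y\<^sup>2 / 4 \<le> w\<^sup>2"
proof -
  have "0 \<le> (c * y / 2 - w)\<^sup>2" by simp
  then show ?thesis by (simp add: power2_diff power_divide power_mult_distrib)
qed

text \<open>
  The majorant depends on neither \<open>N\<close> nor \<open>k\<close>, so it serves all three regimes. Half of the quadratic
  term absorbs the linear one at the price of \<open>w\<^sup>2\<close>. The other half replaces the potential of the \<open>k\<close>
  kept spins, since \<open>log_cosh_gap s \<le> s\<^sup>2 / 2\<close>; so half of the full potential of \<open>N\<close> spins remains
  even when \<open>k\<close> is close to \<open>N\<close>.
\<close>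

lemma field_exponent_le:
  assumes "N \<ge> 1" and "k \<le> N"
  shows "field_exponent N k w y \<le> w\<^sup>2 + tail_const / 2 - tail_const * y\<^sup>2"
proof -
  let ?s = "y / sqrt (sqrt (real N))"
  let ?c = "sqrt (real k / sqrt (real N))"
  have c2: "?c\<^sup>2 = real k / sqrt (real N)" by simp
  have s2: "real k * ?s\<^sup>2 = real k / sqrt (real N) * y\<^sup>2"
    using assms by (simp add: power_divide)
  have "real k * log_cosh_gap ?s \<le> real k * (?s\<^sup>2 / 2)"
    by (intro mult_left_mono log_cosh_gap_le) auto
  then have "real k * log_cosh_gap ?s \<le> real k / sqrt (real N) * y\<^sup>2 / 2"
    using s2 by simp
  moreover have "?c * y * w - real k / sqrt (real N) * y\<^sup>2 / 4 \<le> w\<^sup>2"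
    using linear_minus_square_le[of ?c y w] unfolding c2 .
  moreover have "0 \<le> (real N - real k) * log_cosh_gap ?s"
    using assms log_cosh_gap_nonneg by (intro mult_nonneg_nonneg) auto
  moreover have "tail_const * (2 * y\<^sup>2 - 1) \<le> real N * log_cosh_gap ?s"
    using assms(1) by (rule scaled_log_cosh_gap_ge)
  ultimately show ?thesis
    unfolding field_exponent_def by (simp add: algebra_simps)
qed

lemma integrable_gaussian_bound: "integrable lborel (\<lambda>y. exp (a - tail_const * y\<^sup>2))"
proof -
  have "integrable lborel (\<lambda>y. exp a * exp (0 * y - (2 * tail_const) * y\<^sup>2 / 2))"
    using has_bochner_integral_gaussian_shift[of "2 * tail_const" 0] tail_const_pos
    by (intro integrable_mult_right) (auto simp: has_bochner_integral_iff)
  then show ?thesis by (simp add: exp_diff exp_minus field_simps)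
qed

lemma integrable_field:
  assumes "N \<ge> 1" and "k \<le> N"
  shows "integrable lborel (\<lambda>y. exp (field_exponent N k w y))"
  by (rule Bochner_Integration.integrable_bound[OF integrable_gaussian_bound[of "w\<^sup>2 + tail_const / 2"]])
     (use field_exponent_le[OF assms] in auto)

lemma integral_exp_pos:
  assumes "integrable lborel (\<lambda>y::real. exp (f y :: real))"
  shows "0 < (\<integral>y. exp (f y) \<partial>lborel)"
proof -
  have "(\<integral>y. exp (f y) \<partial>lborel) \<noteq> 0"
    using assms by (subst integral_nonneg_eq_0_iff_AE) (auto simp: eventually_False ae_filter_eq_bot_iff)
  moreover have "0 \<le> (\<integral>y. exp (f y) \<partial>lborel)"
    by simp
  ultimately show ?thesis by linarith
qed

text \<open>
  Convergence along every sequence \<open>w N \<longlonglongrightarrow> w\<^sub>0\<close>, not just for fixed \<open>w\<close>, is what allows the density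
  to be evaluated at a random point that itself depends on \<open>N\<close>. The point \<open>y = 0\<close> is left out because
  there the integrand stays 1 when \<open>k / sqrt N\<close> tends to infinity.
\<close>

lemma field_integral_tendsto:
  assumes k: "\<And>N. N \<ge> 1 \<Longrightarrow> k N \<le> N"
    and w: "w \<longlonglongrightarrow> w\<^sub>0"
    and h [measurable]: "h \<in> borel_measurable lborel"
    and lim: "\<And>y. y \<noteq> 0 \<Longrightarrow> (\<lambda>N. exp (field_exponent N (k N) (w N) y)) \<longlonglongrightarrow> h y"
  shows "(\<lambda>N. field_integral N (k N) (w N)) \<longlonglongrightarrow> (\<integral>y. h y \<partial>lborel)"
proof -
  from w have "Bseq w" by (intro convergent_imp_Bseq convergentI)
  then obtain B where B: "\<And>N. \<bar>w N\<bar> \<le> B" "B > 0" by (auto simp: Bseq_def)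
  have "(\<lambda>N. field_integral (Suc N) (k (Suc N)) (w (Suc N))) \<longlonglongrightarrow> (\<integral>y. h y \<partial>lborel)"
    unfolding field_integral_def
  proof (rule integral_dominated_convergence)
    show "AE y in lborel. (\<lambda>N. exp (field_exponent (Suc N) (k (Suc N)) (w (Suc N)) y)) \<longlonglongrightarrow> h y"
      using AE_lborel_singleton[of 0]
      by eventually_elim (use lim in \<open>auto intro: LIMSEQ_Suc[where f="\<lambda>N. exp (field_exponent N (k N) (w N) _)"]\<close>)
    show "AE y in lborel. norm (exp (field_exponent (Suc N) (k (Suc N)) (w (Suc N)) y))
            \<le> exp (B\<^sup>2 + tail_const / 2 - tail_const * y\<^sup>2)" for N
    proof (rule AE_I2)
      fix y
      have "(w (Suc N))\<^sup>2 \<le> B\<^sup>2"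
        using B(1)[of "Suc N"] by (metis abs_ge_zero power2_abs power_mono)
      then show "norm (exp (field_exponent (Suc N) (k (Suc N)) (w (Suc N)) y))
            \<le> exp (B\<^sup>2 + tail_const / 2 - tail_const * y\<^sup>2)"
        using field_exponent_le[of "Suc N" "k (Suc N)" "w (Suc N)" y] k[of "Suc N"] by simp
    qed
    show "integrable lborel (\<lambda>y. exp (B\<^sup>2 + tail_const / 2 - tail_const * y\<^sup>2))"
      by (rule integrable_gaussian_bound)
  qed auto
  then show ?thesis by (rule LIMSEQ_imp_Suc)
qed

definition limit_integral :: "real \<Rightarrow> real \<Rightarrow> real" where
  "limit_integral \<alpha> w = (\<integral>y. exp (sqrt \<alpha> * y * w - \<alpha> * y\<^sup>2 / 2 - y ^ 4 / 12) \<partial>lborel)"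

lemma scaled_size_tendsto_0:
  assumes "(\<lambda>N. real (k N) / sqrt (real N)) \<longlonglongrightarrow> \<alpha>"
  shows "(\<lambda>N. real (k N) / real N) \<longlonglongrightarrow> 0"
proof -
  have "(\<lambda>N. 1 / sqrt (real N)) \<longlonglongrightarrow> 0" by real_asymp
  from tendsto_mult[OF assms this] show ?thesis by simp
qed

lemma field_integral_tendsto_limit_integral:
  assumes k: "\<And>N. N \<ge> 1 \<Longrightarrow> k N \<le> N"
    and ratio: "(\<lambda>N. real (k N) / sqrt (real N)) \<longlonglongrightarrow> \<alpha>"
    and w: "w \<longlonglongrightarrow> w\<^sub>0"
  shows "(\<lambda>N. field_integral N (k N) (w N)) \<longlonglongrightarrow> limit_integral \<alpha> w\<^sub>0"
  unfolding limit_integral_def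
proof (rule field_integral_tendsto[OF k w])
  fix y :: real
  let ?G = "\<lambda>N. real N * log_cosh_gap (y / sqrt (sqrt (real N)))"
  have "(\<lambda>N. sqrt (real (k N) / sqrt (real N)) * y * w N - real (k N) / sqrt (real N) * y\<^sup>2 / 2
      - (1 - real (k N) / real N) * ?G N)
      \<longlonglongrightarrow> sqrt \<alpha> * y * w\<^sub>0 - \<alpha> * y\<^sup>2 / 2 - (1 - 0) * (y ^ 4 / 12)"
    by (intro tendsto_intros ratio w scaled_log_cosh_gap_tendsto scaled_size_tendsto_0[OF ratio]) auto
  moreover have "\<forall>\<^sub>F N in sequentially. sqrt (real (k N) / sqrt (real N)) * y * w N
      - real (k N) / sqrt (real N) * y\<^sup>2 / 2 - (1 - real (k N) / real N) * ?G N
      = field_exponent N (k N) (w N) y"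
    using eventually_ge_at_top[of 1]
    by eventually_elim (auto simp: field_exponent_def field_simps)
  ultimately have "(\<lambda>N. field_exponent N (k N) (w N) y)
      \<longlonglongrightarrow> sqrt \<alpha> * y * w\<^sub>0 - \<alpha> * y\<^sup>2 / 2 - (1 - 0) * (y ^ 4 / 12)"
    by (rule Lim_transform_eventually)
  then show "(\<lambda>N. exp (field_exponent N (k N) (w N) y))
      \<longlonglongrightarrow> exp (sqrt \<alpha> * y * w\<^sub>0 - \<alpha> * y\<^sup>2 / 2 - y ^ 4 / 12)"
    by (intro tendsto_exp) simp
qed auto

text \<open>
  For \<open>y \<noteq> 0\<close> the term \<open>- (k / sqrt N) * y\<^sup>2 / 4\<close> of the exponent tends to minus infinity,
  and \<open>linear_minus_square_le\<close> bounds the remaining terms by \<open>(w N)\<^sup>2\<close>.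
\<close>

lemma field_integral_tendsto_0:
  assumes k: "\<And>N. N \<ge> 1 \<Longrightarrow> k N \<le> N"
    and ratio: "filterlim (\<lambda>N. real (k N) / sqrt (real N)) at_top sequentially"
    and w: "w \<longlonglongrightarrow> w\<^sub>0"
  shows "(\<lambda>N. field_integral N (k N) (w N)) \<longlonglongrightarrow> 0"
proof -
  have "(\<lambda>N. field_integral N (k N) (w N)) \<longlonglongrightarrow> (\<integral>y. 0 \<partial>(lborel :: real measure))"
  proof (rule field_integral_tendsto[OF k w])
    fix y :: real assume "y \<noteq> 0"
    let ?r = "\<lambda>N. real (k N) / sqrt (real N)"
    have "filterlim (\<lambda>N. - (y\<^sup>2 / 4) * ?r N) at_bot sequentially"
      using \<open>y \<noteq> 0\<close> by (intro filterlim_tendsto_neg_mult_at_bot[OF tendsto_const _ ratio]) auto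
    from tendsto_mult[OF tendsto_exp[OF tendsto_power[OF w, of 2]] filterlim_compose[OF exp_at_bot this]]
    have lim: "(\<lambda>N. exp ((w N)\<^sup>2 + (- (y\<^sup>2 / 4)) * ?r N)) \<longlonglongrightarrow> 0"
      unfolding exp_add by simp
    show "(\<lambda>N. exp (field_exponent N (k N) (w N) y)) \<longlonglongrightarrow> 0"
    proof (rule tendsto_sandwich[OF _ _ tendsto_const lim])
      show "\<forall>\<^sub>F N in sequentially. exp (field_exponent N (k N) (w N) y)
          \<le> exp ((w N)\<^sup>2 + (- (y\<^sup>2 / 4)) * ?r N)"
        using eventually_ge_at_top[of 1]
      proof eventually_elim
        case (elim N)
        have "sqrt (?r N) * y * w N - (sqrt (?r N))\<^sup>2 * y\<^sup>2 / 4 \<le> (w N)\<^sup>2"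
          by (rule linear_minus_square_le)
        moreover have "(sqrt (?r N))\<^sup>2 = ?r N" by simp
        moreover have "0 \<le> (real N - real (k N)) * log_cosh_gap (y / sqrt (sqrt (real N)))"
          using k[OF elim] log_cosh_gap_nonneg by (intro mult_nonneg_nonneg) auto
        ultimately show ?case
          unfolding field_exponent_def by (simp add: algebra_simps)
      qed
    qed auto
  qed auto
  then show ?thesis by simp
qed

section \<open>Total variation, continuous convergence and the central limit theorem\<close>

text \<open>
  Only the positive part of \<open>1 - f\<close> appears. It is at most 1 for every such \<open>f\<close>, so bounded
  convergence applies to the total variation distance without uniform integrability of the densities.
  The supremum is attained at \<open>{f < 1}\<close>, and passing to complements handles the absolute value.
\<close>

lemma tv_dist_density:
  assumes "prob_space Q" and "prob_space (density Q (\<lambda>x. ennreal (f x)))"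
    and f [measurable]: "f \<in> borel_measurable Q" and nonneg: "\<And>x. 0 \<le> f x"
  shows "tv_dist (density Q (\<lambda>x. ennreal (f x))) Q = (\<integral>x. max 0 (1 - f x) \<partial>Q)"
proof -
  interpret Q: prob_space Q by fact
  let ?P = "density Q (\<lambda>x. ennreal (f x))"
  interpret P: prob_space ?P by fact
  have "(\<integral>\<^sup>+x. ennreal (f x) \<partial>Q) = emeasure ?P (space ?P)"
    by (simp add: emeasure_density cong: nn_integral_cong)
  then have "(\<integral>\<^sup>+x. ennreal (f x) \<partial>Q) = 1" by (simp only: P.emeasure_space_1)
  then have int_f: "integrable Q f"
    using nonneg by (intro integrableI_nonneg) auto
  let ?I = "\<integral>x. max 0 (1 - f x) \<partial>Q"
  have int_pos: "integrable Q (\<lambda>x. max 0 (1 - f x))"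
    using int_f by auto
  have diff: "measure Q A - measure ?P A = (\<integral>x. indicator A x * (1 - f x) \<partial>Q)"
    if A: "A \<in> sets Q" for A
  proof -
    note A [measurable]
    have "measure ?P A = (\<integral>x. indicator A x \<partial>?P)"
      using A by simp
    also have "\<dots> = (\<integral>x. f x * indicator A x \<partial>Q)"
      using nonneg by (subst integral_density) auto
    finally have P: "measure ?P A = (\<integral>x. f x * indicator A x \<partial>Q)" .
    have "(\<integral>x. indicator A x * (1 - f x) \<partial>Q) = (\<integral>x. indicator A x - f x * indicator A x \<partial>Q)"
      by (intro Bochner_Integration.integral_cong) (auto simp: algebra_simps)
    also have "\<dots> = (\<integral>x. indicator A x \<partial>Q) - (\<integral>x. f x * indicator A x \<partial>Q)"
    proof (rule Bochner_Integration.integral_diff)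
      show "integrable Q (indicator A :: _ \<Rightarrow> real)"
        using A by (intro integrable_real_indicator) (auto simp: less_top[symmetric])
      show "integrable Q (\<lambda>x. f x * indicator A x)"
        using int_f A by (intro integrable_real_mult_indicator)
    qed
    finally show ?thesis using P A by simp
  qed
  have upper: "measure Q A - measure ?P A \<le> ?I" if A: "A \<in> sets Q" for A
  proof -
    note A [measurable]
    have "(\<integral>x. indicator A x * (1 - f x) \<partial>Q) \<le> ?I"
    proof (rule integral_mono[OF _ int_pos])
      have "integrable Q (\<lambda>x. (1 - f x) * indicator A x)"
        using int_f A by (intro integrable_real_mult_indicator) auto
      then show "integrable Q (\<lambda>x. indicator A x * (1 - f x))" by (simp add: mult.commute)
    qed (auto simp: indicator_def)
    with diff[OF A] show ?thesis by simp
  qed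
  have bound: "\<bar>measure ?P A - measure Q A\<bar> \<le> ?I" if A: "A \<in> sets Q" for A
  proof -
    have "measure Q (space Q - A) = 1 - measure Q A"
      using A by (rule Q.prob_compl)
    moreover have "measure ?P (space Q - A) = 1 - measure ?P A"
      using P.prob_compl[of A] A by simp
    moreover have "space Q - A \<in> sets Q" using A by auto
    ultimately show ?thesis
      using upper[OF A] upper[of "space Q - A"] by linarith
  qed
  let ?A = "{x \<in> space Q. f x < 1}"
  have A: "?A \<in> sets Q" by measurable
  have "?I = (\<integral>x. indicator ?A x * (1 - f x) \<partial>Q)"
    by (intro Bochner_Integration.integral_cong) (auto simp: indicator_def)
  with diff[OF A] bound[OF A] have att: "\<bar>measure ?P ?A - measure Q ?A\<bar> = ?I" by linarith
  show ?thesis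
    unfolding tv_dist_def
  proof (rule cSup_eq_maximum)
    show "?I \<in> (\<lambda>A. \<bar>measure ?P A - measure Q A\<bar>) ` sets ?P"
      using A att by (intro image_eqI[of _ _ ?A]) auto
  qed (use bound in auto)
qed

text \<open>
  In Skorohod's representation the random points converge pointwise, so both the integrand and the
  measure may vary with \<open>n\<close>.
\<close>

lemma expectation_tendsto_of_continuous_convergence:
  fixes F :: "nat \<Rightarrow> real \<Rightarrow> real"
  assumes mu: "\<And>n. real_distribution (\<mu> n)" and M: "real_distribution M"
    and conv: "weak_conv_m \<mu> M"
    and F [measurable]: "\<And>n. F n \<in> borel_measurable borel"
    and F0 [measurable]: "F\<^sub>0 \<in> borel_measurable borel"
    and bound: "\<And>n x. \<bar>F n x\<bar> \<le> B"
    and lim: "\<And>w w\<^sub>0. w \<longlonglongrightarrow> w\<^sub>0 \<Longrightarrow> (\<lambda>n. F n (w n)) \<longlonglongrightarrow> F\<^sub>0 w\<^sub>0"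
  shows "(\<lambda>n. \<integral>x. F n x \<partial>\<mu> n) \<longlonglongrightarrow> (\<integral>x. F\<^sub>0 x \<partial>M)"
proof -
  from Skorohod[OF mu M conv] obtain \<Omega> :: "real measure" and Y and Y\<^sub>0 where
    prob: "prob_space \<Omega>" and Y [measurable]: "\<And>n. Y n \<in> borel_measurable \<Omega>"
    and distr_Y: "\<And>n. distr \<Omega> borel (Y n) = \<mu> n"
    and Y0 [measurable]: "Y\<^sub>0 \<in> borel_measurable \<Omega>" and distr_Y0: "distr \<Omega> borel Y\<^sub>0 = M"
    and Y_lim: "\<And>x. x \<in> space \<Omega> \<Longrightarrow> (\<lambda>n. Y n x) \<longlonglongrightarrow> Y\<^sub>0 x"
    by force
  interpret prob_space \<Omega> by fact
  have "(\<lambda>n. \<integral>x. F n (Y n x) \<partial>\<Omega>) \<longlonglongrightarrow> (\<integral>x. F\<^sub>0 (Y\<^sub>0 x) \<partial>\<Omega>)"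
  proof (rule integral_dominated_convergence)
    show "AE x in \<Omega>. (\<lambda>n. F n (Y n x)) \<longlonglongrightarrow> F\<^sub>0 (Y\<^sub>0 x)"
      by (intro AE_I2 lim Y_lim)
    show "AE x in \<Omega>. norm (F n (Y n x)) \<le> B" for n
      using bound by simp
  qed auto
  also have "(\<lambda>n. \<integral>x. F n (Y n x) \<partial>\<Omega>) = (\<lambda>n. \<integral>x. F n x \<partial>\<mu> n)"
    by (auto simp: integral_distr fun_eq_iff simp flip: distr_Y)
  also have "(\<integral>x. F\<^sub>0 (Y\<^sub>0 x) \<partial>\<Omega>) = (\<integral>x. F\<^sub>0 x \<partial>M)"
    by (simp add: integral_distr flip: distr_Y0)
  finally show ?thesis .
qed

lemma space_fair_spin [simp]: "space fair_spin = {-1, 1}"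
  by (simp add: fair_spin_def space_point_measure)

lemma sets_fair_spin [measurable_cong, simp]: "sets fair_spin = sets (count_space {-1, 1})"
  by (simp add: fair_spin_def sets_point_measure)

lemma fair_spin_conv_ennreal: "fair_spin = point_measure {-1, 1} (\<lambda>_. ennreal (1 / 2))"
  by (simp add: fair_spin_def ennreal_divide_numeral[of 1, simplified])

lemma emeasure_fair_spin_singleton: "x \<in> {-1, 1} \<Longrightarrow> emeasure fair_spin {x} = ennreal (1 / 2)"
  unfolding fair_spin_conv_ennreal by (subst emeasure_point_measure_finite) auto

lemma prob_space_fair_spin: "prob_space fair_spin"
proof
  have "emeasure fair_spin {-1, 1} = (\<Sum>x\<in>{-1, 1 :: real}. ennreal (1 / 2))"
    unfolding fair_spin_conv_ennreal by (rule emeasure_point_measure_finite) auto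
  also have "\<dots> = ennreal (\<Sum>x\<in>{-1, 1 :: real}. 1 / 2)"
    by (rule sum_ennreal) simp
  finally show "emeasure fair_spin (space fair_spin) = 1"
    by simp
qed

lemma integral_fair_spin: "(\<integral>x. f x \<partial>fair_spin) = (f (-1) + f 1) / (2::real)"
  unfolding fair_spin_conv_ennreal
  by (subst lebesgue_integral_point_measure_finite) auto

definition spin_sum :: "nat \<Rightarrow> (nat \<Rightarrow> real) \<Rightarrow> real" where
  "spin_sum k \<tau> = (\<Sum>i=1..k. \<tau> i)"

lemma product_prob_space_fair_spin: "product_prob_space (\<lambda>_::nat. fair_spin)"
  by (intro product_prob_spaceI prob_space_fair_spin)

lemma measurable_fair_spin_borel: "(\<lambda>x. x) \<in> measurable fair_spin borel"
  by (simp cong: measurable_cong_sets)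

lemma measurable_spin_sum [measurable]: "spin_sum k \<in> borel_measurable (fair_spins k)"
proof -
  have "(\<lambda>\<tau>. \<tau> i) \<in> borel_measurable (\<Pi>\<^sub>M i\<in>{1..k}. fair_spin)" if "i \<in> {1..k}" for i
    using measurable_compose[OF measurable_component_singleton[OF that] measurable_fair_spin_borel] .
  then show ?thesis
    unfolding spin_sum_def[abs_def] fair_spins_def by (intro borel_measurable_sum)
qed

lemma prob_space_fair_spins: "prob_space (fair_spins k)"
  unfolding fair_spins_def by (intro prob_space_PiM prob_space_fair_spin)

definition spin_sum_law :: "nat \<Rightarrow> real measure" where
  "spin_sum_law k = distr (fair_spins k) borel (\<lambda>\<tau>. spin_sum k \<tau> / sqrt (real k))"

lemma real_distribution_spin_sum_law: "real_distribution (spin_sum_law k)"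
  unfolding spin_sum_law_def
  by (rule prob_space.real_distribution_distr[OF prob_space_fair_spins]) measurable

text \<open>
  The finite products are projections of one infinite product. The central limit theorem is applied to
  its coordinates, shifted by one because spins are numbered from 1 and the terms of the sum from 0.
\<close>

lemma spin_sum_central_limit: "weak_conv_m spin_sum_law std_normal_distribution"
proof -
  let ?P = "\<Pi>\<^sub>M i\<in>(UNIV :: nat set). fair_spin"
  interpret product_prob_space "\<lambda>_::nat. fair_spin" UNIV
    by (rule product_prob_space_fair_spin)
  interpret P: prob_space ?P
    by (intro prob_space_PiM prob_space_fair_spin)
  define X where "X i \<omega> = (\<omega> (Suc i) :: real)" for i :: nat and \<omega> :: "nat \<Rightarrow> real"
  have X_rv: "X i \<in> measurable ?P fair_spin" for i
    unfolding X_def[abs_def] by measurable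
  have [measurable]: "X i \<in> borel_measurable ?P" for i
    using measurable_compose[OF X_rv measurable_fair_spin_borel] .
  have X_distr: "distr ?P fair_spin (X i) = fair_spin" for i
    using PiM_component[of "Suc i"] by (simp add: X_def[abs_def])
  have "P.indep_vars (\<lambda>_. fair_spin) X UNIV"
  proof (subst P.indep_vars_iff_distr_eq_PiM)
    have "distr ?P ?P (\<lambda>\<omega>. \<lambda>i\<in>UNIV. \<omega> (Suc i)) = ?P"
      by (rule distr_PiM_reindex[where f=Suc]) (auto intro: prob_space_fair_spin)
    then show "distr ?P (\<Pi>\<^sub>M i\<in>UNIV. fair_spin) (\<lambda>x. \<lambda>i\<in>UNIV. X i x)
        = (\<Pi>\<^sub>M i\<in>UNIV. distr ?P fair_spin (X i))"
      unfolding X_distr by (simp add: X_def)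
  qed (use X_rv in auto)
  then have indep: "P.indep_vars (\<lambda>_. borel) X UNIV"
    by (rule P.indep_vars_compose2[where Y="\<lambda>_ x. x"]) (rule measurable_fair_spin_borel)
  have integral_X: "(\<integral>\<omega>. g (X i \<omega>) \<partial>?P) = (g (-1) + g 1) / 2" for i and g :: "real \<Rightarrow> real"
  proof -
    have "(\<integral>\<omega>. g (X i \<omega>) \<partial>?P) = (\<integral>x. g x \<partial>distr ?P fair_spin (X i))"
      using X_rv by (subst integral_distr) (auto simp: measurable_cong_sets[OF sets_fair_spin refl])
    then show ?thesis by (simp add: X_distr integral_fair_spin)
  qed
  have sq: "(X i \<omega>)\<^sup>2 = 1" if "\<omega> \<in> space ?P" for i \<omega>
  proof -
    have "X i \<omega> \<in> {-1, 1}"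
      using measurable_space[OF X_rv that] by simp
    then show ?thesis by auto
  qed
  have "weak_conv_m (\<lambda>n. distr ?P borel (\<lambda>\<omega>. (\<Sum>i<n. X i \<omega>) / sqrt (real n * 1\<^sup>2)))
      std_normal_distribution"
  proof (rule P.central_limit_theorem_zero_mean)
    show "P.indep_vars (\<lambda>i. borel) X UNIV" by (rule indep)
    show mean: "P.expectation (X n) = 0" for n
      using integral_X[of "\<lambda>x. x" n] by simp
    show "P.variance (X n) = 1\<^sup>2" for n
      using integral_X[of "\<lambda>x. x\<^sup>2" n] by (simp add: mean)
    show "integrable ?P (\<lambda>\<omega>. (X n \<omega>)\<^sup>2)" for n
    proof -
      have "integrable ?P (\<lambda>\<omega>. (X n \<omega>)\<^sup>2) \<longleftrightarrow> integrable ?P (\<lambda>_. 1 :: real)"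
        by (intro Bochner_Integration.integrable_cong) (use sq in auto)
      then show ?thesis by simp
    qed
    show "distr ?P borel (X n) = distr fair_spin borel (\<lambda>x. x)" for n
    proof -
      have "distr (distr ?P fair_spin (X n)) borel (\<lambda>x. x) = distr ?P borel (\<lambda>\<omega>. X n \<omega>)"
        by (subst distr_distr[OF measurable_fair_spin_borel X_rv]) (simp add: comp_def)
      then show ?thesis by (simp add: X_distr)
    qed
  qed simp
  moreover have "distr ?P borel (\<lambda>\<omega>. (\<Sum>i<n. X i \<omega>) / sqrt (real n * 1\<^sup>2)) = spin_sum_law n" for n
  proof -
    have [measurable]: "spin_sum n \<in> borel_measurable (\<Pi>\<^sub>M i\<in>{1..n}. fair_spin)"
      using measurable_spin_sum unfolding fair_spins_def .
    have "spin_sum_law n = distr (distr ?P (\<Pi>\<^sub>M i\<in>{1..n}. fair_spin) (\<lambda>\<omega>. restrict \<omega> {1..n}))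
        borel (\<lambda>\<tau>. spin_sum n \<tau> / sqrt (real n))"
      unfolding spin_sum_law_def fair_spins_def by (subst distr_PiM_restrict_finite) auto
    also have "\<dots> = distr ?P borel (\<lambda>\<omega>. spin_sum n (restrict \<omega> {1..n}) / sqrt (real n))"
      by (subst distr_distr[OF _ measurable_restrict_subset]) (auto simp: comp_def simp del: One_nat_def)
    also have "(\<lambda>\<omega>. spin_sum n (restrict \<omega> {1..n}) / sqrt (real n))
        = (\<lambda>\<omega>. (\<Sum>i<n. X i \<omega>) / sqrt (real n * 1\<^sup>2))"
      by (simp add: spin_sum_def X_def fun_eq_iff sum.atLeast1_atMost_eq)
    finally show ?thesis ..
  qed
  ultimately show ?thesis by (simp add: fun_eq_iff[symmetric])
qed

lemma finite_spin_configs [simp]: "finite (spin_configs N)"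
  by (simp add: spin_configs_def finite_PiE)

lemma restrict_spin_configs:
  "k \<le> N \<Longrightarrow> \<sigma> \<in> spin_configs N \<Longrightarrow> restrict \<sigma> {1..k} \<in> spin_configs k"
  by (auto simp: spin_configs_def PiE_iff)

lemma PiM_count_space_spins:
  "(\<Pi>\<^sub>M i\<in>{1..k}. count_space {-1, 1 :: real}) = count_space (spin_configs k)"
  unfolding spin_configs_def by (rule count_space_PiM_finite) auto

section \<open>Marginals of the Curie-Weiss measure\<close>

text \<open>
  Writing the extensions of \<open>\<tau>\<close> as a product set lets the sum over them factorize.
\<close>

lemma spin_configs_extending_eq:
  assumes "k \<le> N" and \<tau>: "\<tau> \<in> spin_configs k"
  shows "{\<sigma> \<in> spin_configs N. restrict \<sigma> {1..k} = \<tau>}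
    = PiE {1..N} (\<lambda>i. if i \<le> k then {\<tau> i} else {-1, 1})"
proof (intro set_eqI iffI)
  fix \<sigma> assume "\<sigma> \<in> {\<sigma> \<in> spin_configs N. restrict \<sigma> {1..k} = \<tau>}"
  then show "\<sigma> \<in> PiE {1..N} (\<lambda>i. if i \<le> k then {\<tau> i} else {-1, 1})"
    by (auto simp: spin_configs_def PiE_iff split: if_splits)
next
  fix \<sigma> assume \<sigma>: "\<sigma> \<in> PiE {1..N} (\<lambda>i. if i \<le> k then {\<tau> i} else {-1, 1})"
  have "\<sigma> i = \<tau> i" if "i \<in> {1..k}" for i
    using PiE_mem[OF \<sigma>, of i] that assms(1) by auto
  then have "restrict \<sigma> {1..k} = \<tau>"
    using \<tau> by (intro extensionalityI[of _ "{1..k}"]) (auto simp: spin_configs_def PiE_iff)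
  moreover have "\<sigma> i \<in> {-1, 1}" if "i \<in> {1..N}" for i
  proof (cases "i \<le> k")
    case True
    then show ?thesis
      using PiE_mem[OF \<sigma> that] that \<tau> by (auto simp: spin_configs_def PiE_iff)
  next
    case False
    then show ?thesis
      using PiE_mem[OF \<sigma> that] by simp
  qed
  then have "\<sigma> \<in> spin_configs N"
    using \<sigma> by (auto simp: spin_configs_def PiE_iff)
  ultimately show "\<sigma> \<in> {\<sigma> \<in> spin_configs N. restrict \<sigma> {1..k} = \<tau>}" by simp
qed

lemma sum_exp_spin_sum_extending:
  assumes "k \<le> N" and \<tau>: "\<tau> \<in> spin_configs k"
  shows "(\<Sum>\<sigma> | \<sigma> \<in> spin_configs N \<and> restrict \<sigma> {1..k} = \<tau>. exp (s * spin_sum N \<sigma>))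
    = exp (s * spin_sum k \<tau>) * (2 * cosh s) ^ (N - k)"
proof -
  let ?B = "\<lambda>i. if i \<le> k then {\<tau> i} else {-1, 1}"
  have "(\<Sum>\<sigma> | \<sigma> \<in> spin_configs N \<and> restrict \<sigma> {1..k} = \<tau>. exp (s * spin_sum N \<sigma>))
      = (\<Sum>\<sigma>\<in>PiE {1..N} ?B. \<Prod>i\<in>{1..N}. exp (s * \<sigma> i))"
    unfolding spin_configs_extending_eq[OF assms] spin_sum_def sum_distrib_left
    by (simp add: exp_sum)
  also have "\<dots> = (\<Prod>i\<in>{1..N}. \<Sum>x\<in>?B i. exp (s * x))"
    by (rule prod_sum_PiE[symmetric]) auto
  also have "\<dots> = (\<Prod>i\<in>{1..N}. if i \<le> k then exp (s * \<tau> i) else 2 * cosh s)"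
    by (intro prod.cong) (auto simp: cosh_field_def)
  also have "\<dots> = (\<Prod>i\<in>{1..k}. exp (s * \<tau> i)) * (2 * cosh s) ^ (N - k)"
  proof -
    have "{1..N} \<inter> {i. i \<le> k} = {1..k}" "{1..N} \<inter> - {i. i \<le> k} = {k<..N}"
      using assms(1) by auto
    then show ?thesis by (simp add: prod.If_cases del: One_nat_def)
  qed
  also have "(\<Prod>i\<in>{1..k}. exp (s * \<tau> i)) = exp (s * spin_sum k \<tau>)"
    by (simp add: spin_sum_def sum_distrib_left exp_sum)
  finally show ?thesis .
qed

lemma cw_weight_eq_spin_sum: "cw_weight N \<sigma> = exp ((spin_sum N \<sigma>)\<^sup>2 / (2 * real N))"
  by (simp add: cw_weight_def spin_sum_def power2_eq_square sum_product)

lemma cw_weight_field_representation: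
  assumes "N \<ge> 1"
  shows "has_bochner_integral lborel
    (\<lambda>y. exp (y / sqrt (sqrt (real N)) * spin_sum N \<sigma>) * exp (- sqrt (real N) * y\<^sup>2 / 2))
    (sqrt (2 * pi / sqrt (real N)) * cw_weight N \<sigma>)"
proof -
  let ?r = "sqrt (real N)"
  have r: "0 < ?r" using assms by simp
  have "(spin_sum N \<sigma> / sqrt ?r)\<^sup>2 / (2 * ?r) = (spin_sum N \<sigma>)\<^sup>2 / (2 * real N)"
    using assms by (simp add: power_divide)
  then show ?thesis
    using has_bochner_integral_gaussian_shift[OF r, of "spin_sum N \<sigma> / sqrt ?r"]
    by (simp add: cw_weight_eq_spin_sum mult.commute flip: exp_add)
qed

lemma exp_field_exponent:
  assumes "N \<ge> 1" and "k \<le> N" and "k = 0 \<Longrightarrow> S = 0"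
  shows "exp (y / sqrt (sqrt (real N)) * S) * cosh (y / sqrt (sqrt (real N))) ^ (N - k)
       * exp (- sqrt (real N) * y\<^sup>2 / 2) = exp (field_exponent N k (S / sqrt (real k)) y)"
proof -
  let ?s = "y / sqrt (sqrt (real N))"
  have s2: "real N * ?s\<^sup>2 = sqrt (real N) * y\<^sup>2" "real k * ?s\<^sup>2 = real k / sqrt (real N) * y\<^sup>2"
    using assms by (simp_all add: power_divide field_simps)
  have S: "sqrt (real k / sqrt (real N)) * y * (S / sqrt (real k)) = ?s * S"
    using assms(1,3) by (cases "k = 0") (auto simp: real_sqrt_divide)
  have "cosh ?s ^ (N - k) = exp ((real N - real k) * ln (cosh ?s))"
    using assms(2) by (simp add: exp_of_nat_mult flip: of_nat_diff)
  moreover have "field_exponent N k (S / sqrt (real k)) y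
      = ?s * S + (real N - real k) * ln (cosh ?s) + - sqrt (real N) * y\<^sup>2 / 2"
  proof -
    have "(real N - real k) * log_cosh_gap ?s
        = (real N * ?s\<^sup>2 - real k * ?s\<^sup>2) / 2 - (real N - real k) * ln (cosh ?s)"
      by (simp add: log_cosh_gap_def algebra_simps)
    then show ?thesis
      unfolding field_exponent_def S s2 by (simp add: field_simps)
  qed
  ultimately show ?thesis by (simp only: exp_add)
qed

text \<open>
  Inside the field integral the sum over the spins outside \<open>{1..k}\<close> factorizes. For \<open>k = 0\<close> this
  becomes the partition function, where \<open>spin_sum 0 \<tau> / sqrt 0 = 0\<close>.
\<close>

lemma sum_cw_weight_extending:
  assumes "N \<ge> 1" and "k \<le> N" and \<tau>: "\<tau> \<in> spin_configs k"
  shows "sqrt (2 * pi / sqrt (real N)) *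
      (\<Sum>\<sigma> | \<sigma> \<in> spin_configs N \<and> restrict \<sigma> {1..k} = \<tau>. cw_weight N \<sigma>)
    = 2 ^ (N - k) * field_integral N k (spin_sum k \<tau> / sqrt (real k))"
proof -
  let ?E = "{\<sigma>. \<sigma> \<in> spin_configs N \<and> restrict \<sigma> {1..k} = \<tau>}"
  let ?s = "\<lambda>y. y / sqrt (sqrt (real N))"
  let ?g = "\<lambda>y. exp (- sqrt (real N) * y\<^sup>2 / 2)"
  have "has_bochner_integral lborel (\<lambda>y. \<Sum>\<sigma>\<in>?E. exp (?s y * spin_sum N \<sigma>) * ?g y)
      (\<Sum>\<sigma>\<in>?E. sqrt (2 * pi / sqrt (real N)) * cw_weight N \<sigma>)"
    by (intro has_bochner_integral_sum cw_weight_field_representation assms)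
  moreover have "(\<Sum>\<sigma>\<in>?E. exp (?s y * spin_sum N \<sigma>) * ?g y)
      = 2 ^ (N - k) * exp (field_exponent N k (spin_sum k \<tau> / sqrt (real k)) y)" for y
  proof -
    have "(\<Sum>\<sigma>\<in>?E. exp (?s y * spin_sum N \<sigma>) * ?g y)
        = exp (?s y * spin_sum k \<tau>) * (2 * cosh (?s y)) ^ (N - k) * ?g y"
      unfolding sum_distrib_right[symmetric] by (subst sum_exp_spin_sum_extending[OF assms(2,3)]) simp
    also have "\<dots> = 2 ^ (N - k) * (exp (?s y * spin_sum k \<tau>) * cosh (?s y) ^ (N - k) * ?g y)"
      by (simp only: power_mult_distrib mult_ac)
    also have "\<dots> = 2 ^ (N - k) * exp (field_exponent N k (spin_sum k \<tau> / sqrt (real k)) y)"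
      by (subst exp_field_exponent[OF assms(1,2)]) (auto simp: spin_sum_def)
    finally show ?thesis .
  qed
  ultimately have "has_bochner_integral lborel
      (\<lambda>y. 2 ^ (N - k) * exp (field_exponent N k (spin_sum k \<tau> / sqrt (real k)) y))
      (\<Sum>\<sigma>\<in>?E. sqrt (2 * pi / sqrt (real N)) * cw_weight N \<sigma>)" by simp
  then show ?thesis
    by (simp add: has_bochner_integral_iff field_integral_def sum_distrib_left)
qed

lemma cw_partition_eq:
  assumes "N \<ge> 1"
  shows "sqrt (2 * pi / sqrt (real N)) * cw_partition N = 2 ^ N * field_integral N 0 0"
proof -
  have \<tau>: "(\<lambda>_. undefined) \<in> spin_configs 0" by (simp add: spin_configs_def)
  have "{\<sigma>. \<sigma> \<in> spin_configs N \<and> restrict \<sigma> {1..0} = (\<lambda>_. undefined)} = spin_configs N"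
    by (auto simp: restrict_def)
  with sum_cw_weight_extending[OF assms _ \<tau>] show ?thesis
    by (simp add: cw_partition_def)
qed

definition field_ratio :: "nat \<Rightarrow> nat \<Rightarrow> real \<Rightarrow> real" where
  "field_ratio N k w = field_integral N k w / field_integral N 0 0"

lemma measurable_field_ratio [measurable]: "field_ratio N k \<in> borel_measurable borel"
  unfolding field_ratio_def[abs_def] by measurable

lemma field_integral_pos: "N \<ge> 1 \<Longrightarrow> k \<le> N \<Longrightarrow> 0 < field_integral N k w"
  unfolding field_integral_def by (intro integral_exp_pos integrable_field)

lemma field_integral_nonneg: "0 \<le> field_integral N k w"
  unfolding field_integral_def by simp

lemma field_ratio_nonneg: "0 \<le> field_ratio N k w"
  by (simp add: field_ratio_def field_integral_nonneg)

text \<open>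
  In the quotient of \<open>sum_cw_weight_extending\<close> and \<open>cw_partition_eq\<close> the Gaussian constant cancels, and
  \<open>2 ^ (N - k) / 2 ^ N\<close> is the mass of \<open>\<tau>\<close> under fair spins. The normalized spin sum is thus a sufficient
  statistic, which moves the comparison of the two laws to the real line.
\<close>

lemma cw_marginal_eq_density:
  assumes "N \<ge> 1" and "k \<le> N"
  shows "cw_marginal N k
    = density (fair_spins k) (\<lambda>\<tau>. ennreal (field_ratio N k (spin_sum k \<tau> / sqrt (real k))))"
proof (rule measure_eqI_countable)
  have sets: "sets (cw_marginal N k) = Pow (spin_configs k)"
    unfolding cw_marginal_def sets_distr PiM_count_space_spins by simp
  then show "sets (cw_marginal N k) = Pow (spin_configs k)" .
  then have sets_fair: "sets (fair_spins k) = Pow (spin_configs k)"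
    by (simp add: sets_cw_marginal_eq)
  then show "sets (density (fair_spins k)
      (\<lambda>\<tau>. ennreal (field_ratio N k (spin_sum k \<tau> / sqrt (real k))))) = Pow (spin_configs k)"
    by simp
  show "countable (spin_configs k)" by (intro countable_finite) simp
  fix \<tau> assume \<tau>: "\<tau> \<in> spin_configs k"
  let ?w = "spin_sum k \<tau> / sqrt (real k)"
  let ?E = "{\<sigma>. \<sigma> \<in> spin_configs N \<and> restrict \<sigma> {1..k} = \<tau>}"
  have G: "0 < sqrt (2 * pi / sqrt (real N))" using assms by simp
  have J: "0 < field_integral N 0 0" using assms by (intro field_integral_pos) auto
  have Z: "0 < cw_partition N"
  proof -
    have "0 < sqrt (2 * pi / sqrt (real N)) * cw_partition N"
      unfolding cw_partition_eq[OF assms(1)] using J by simp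
    then show ?thesis using G by (simp add: zero_less_mult_iff)
  qed
  have "emeasure (cw_marginal N k) {\<tau>} = emeasure (curie_weiss N) ?E"
    unfolding cw_marginal_def PiM_count_space_spins curie_weiss_def
  proof (subst emeasure_distr)
    show "(\<lambda>\<sigma>. restrict \<sigma> {1..k}) \<in> measurable
        (point_measure (spin_configs N) (\<lambda>\<sigma>. ennreal (cw_weight N \<sigma> / cw_partition N)))
        (count_space (spin_configs k))"
      using restrict_spin_configs[OF assms(2)] by auto
  qed (use \<tau> in \<open>auto simp: space_point_measure intro!: arg_cong2[where f=emeasure]\<close>)
  also have "\<dots> = (\<Sum>\<sigma>\<in>?E. ennreal (cw_weight N \<sigma> / cw_partition N))"
    unfolding curie_weiss_def by (rule emeasure_point_measure_finite) auto
  also have "\<dots> = ennreal (\<Sum>\<sigma>\<in>?E. cw_weight N \<sigma> / cw_partition N)"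
    using Z by (intro sum_ennreal) (auto simp: cw_weight_def)
  also have "(\<Sum>\<sigma>\<in>?E. cw_weight N \<sigma> / cw_partition N)
      = (sqrt (2 * pi / sqrt (real N)) * (\<Sum>\<sigma>\<in>?E. cw_weight N \<sigma>))
        / (sqrt (2 * pi / sqrt (real N)) * cw_partition N)"
    using assms(1) by (simp add: sum_divide_distrib)
  also have "\<dots> = field_ratio N k ?w * (1 / 2) ^ k"
    unfolding sum_cw_weight_extending[OF assms \<tau>] cw_partition_eq[OF assms(1)]
    using assms(2) by (simp add: field_ratio_def power_diff power_one_over)
  finally have lhs: "emeasure (cw_marginal N k) {\<tau>} = ennreal (field_ratio N k ?w * (1 / 2) ^ k)" .
  have fair: "emeasure (fair_spins k) {\<tau>} = ennreal ((1 / 2) ^ k)"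
  proof -
    interpret product_prob_space "\<lambda>_::nat. fair_spin" "{1..k}"
      by (rule product_prob_space_fair_spin)
    have \<tau>_mem: "\<tau> i \<in> {-1, 1}" if "i \<in> {1..k}" for i
      using \<tau> that unfolding spin_configs_def by (rule PiE_mem)
    have "{\<tau>} = PiE {1..k} (\<lambda>i. {\<tau> i})"
      using \<tau> by (subst PiE_singleton) (auto simp: spin_configs_def PiE_iff)
    then have "emeasure (fair_spins k) {\<tau>} = (\<Prod>i\<in>{1..k}. emeasure fair_spin {\<tau> i})"
      unfolding fair_spins_def using \<tau>_mem by (simp only:) (intro emeasure_PiM, auto)
    also have "\<dots> = (\<Prod>i\<in>{1..k}. ennreal (1 / 2))"
      using \<tau>_mem by (intro prod.cong emeasure_fair_spin_singleton) auto
    also have "\<dots> = ennreal ((1 / 2) ^ k)"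
      by (simp only: prod_constant card_atLeastAtMost ennreal_power) simp
    finally show ?thesis .
  qed
  have "emeasure (density (fair_spins k)
      (\<lambda>\<tau>. ennreal (field_ratio N k (spin_sum k \<tau> / sqrt (real k))))) {\<tau>}
      = (\<integral>\<^sup>+x. ennreal (field_ratio N k ?w) * indicator {\<tau>} x \<partial>fair_spins k)"
    using \<tau> by (subst emeasure_density)
      (auto simp: sets_fair intro!: nn_integral_cong split: split_indicator)
  also have "\<dots> = ennreal (field_ratio N k ?w) * ennreal ((1 / 2) ^ k)"
    using \<tau> by (subst nn_integral_cmult_indicator) (auto simp: sets_fair fair)
  also have "\<dots> = ennreal (field_ratio N k ?w * (1 / 2) ^ k)"
    by (rule ennreal_mult[symmetric]) (auto simp: field_ratio_nonneg)
  finally show "emeasure (cw_marginal N k) {\<tau>} = emeasure (density (fair_spins k)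
      (\<lambda>\<tau>. ennreal (field_ratio N k (spin_sum k \<tau> / sqrt (real k))))) {\<tau>}"
    using lhs by simp
qed

lemma prob_space_cw_marginal:
  assumes "k \<le> N"
  shows "prob_space (cw_marginal N k)"
  unfolding cw_marginal_def
proof (rule prob_space.prob_space_distr[OF prob_space_curie_weiss])
  show "(\<lambda>\<sigma>. restrict \<sigma> {1..k}) \<in> curie_weiss N \<rightarrow>\<^sub>M (\<Pi>\<^sub>M i\<in>{1..k}. count_space {-1, 1})"
    unfolding PiM_count_space_spins curie_weiss_def using restrict_spin_configs[OF assms] by auto
qed

lemma tv_dist_cw_marginal:
  assumes "N \<ge> 1" and "k \<le> N"
  shows "tv_dist (cw_marginal N k) (fair_spins k)
    = (\<integral>w. max 0 (1 - field_ratio N k w) \<partial>spin_sum_law k)"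
proof -
  have "tv_dist (cw_marginal N k) (fair_spins k)
      = (\<integral>\<tau>. max 0 (1 - field_ratio N k (spin_sum k \<tau> / sqrt (real k))) \<partial>fair_spins k)"
    unfolding cw_marginal_eq_density[OF assms]
  proof (rule tv_dist_density)
    show "prob_space (density (fair_spins k)
        (\<lambda>\<tau>. ennreal (field_ratio N k (spin_sum k \<tau> / sqrt (real k)))))"
      using prob_space_cw_marginal[OF assms(2)] unfolding cw_marginal_eq_density[OF assms] .
  qed (auto simp: prob_space_fair_spins field_ratio_nonneg)
  then show ?thesis
    by (simp add: spin_sum_law_def integral_distr)
qed

text \<open>
  The three regimes differ only in the limit \<open>L\<close> of the densities.
\<close>

lemma tv_dist_cw_marginal_tendsto:
  assumes k_range: "\<And>N. N \<ge> 1 \<Longrightarrow> k N \<le> N"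
    and k_lim: "filterlim k at_top sequentially"
    and L [measurable]: "L \<in> borel_measurable borel"
    and lim: "\<And>w w\<^sub>0. w \<longlonglongrightarrow> w\<^sub>0 \<Longrightarrow> (\<lambda>N. field_ratio N (k N) (w N)) \<longlonglongrightarrow> L w\<^sub>0"
  shows "(\<lambda>N. tv_dist (cw_marginal N (k N)) (fair_spins (k N)))
    \<longlonglongrightarrow> (\<integral>w. max 0 (1 - L w) \<partial>std_normal_distribution)"
proof -
  have "weak_conv_m (\<lambda>N. spin_sum_law (k N)) std_normal_distribution"
    using spin_sum_central_limit k_lim unfolding weak_conv_m_def weak_conv_def
    by (auto intro: filterlim_compose)
  then have "(\<lambda>N. \<integral>w. max 0 (1 - field_ratio N (k N) w) \<partial>spin_sum_law (k N))
      \<longlonglongrightarrow> (\<integral>w. max 0 (1 - L w) \<partial>std_normal_distribution)"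
  proof (intro expectation_tendsto_of_continuous_convergence[where B=1])
    show "\<bar>max 0 (1 - field_ratio N (k N) w)\<bar> \<le> 1" for N w
      using field_ratio_nonneg[of N "k N" w] by (auto simp: max_def)
    show "(\<lambda>N. max 0 (1 - field_ratio N (k N) (w N))) \<longlonglongrightarrow> max 0 (1 - L w\<^sub>0)"
      if "w \<longlonglongrightarrow> w\<^sub>0" for w w\<^sub>0
      by (intro tendsto_intros lim that)
  qed (auto intro: real_distribution_spin_sum_law real_dist_normal_dist)
  then show ?thesis
  proof (rule Lim_transform_eventually)
    show "\<forall>\<^sub>F N in sequentially. (\<integral>w. max 0 (1 - field_ratio N (k N) w) \<partial>spin_sum_law (k N))
        = tv_dist (cw_marginal N (k N)) (fair_spins (k N))"
      using eventually_ge_at_top[of 1]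
      by eventually_elim (simp add: tv_dist_cw_marginal k_range)
  qed
qed

section \<open>The limiting density and the Gaussian location mixture\<close>

lemma limit_exponent_le:
  assumes "0 \<le> \<alpha>"
  shows "sqrt \<alpha> * y * w - \<alpha> * y\<^sup>2 / 2 - y ^ 4 / 12 \<le> w\<^sup>2 + tail_const - tail_const * y\<^sup>2"
proof -
  have "sqrt \<alpha> * y * w - \<alpha> * y\<^sup>2 / 4 \<le> w\<^sup>2"
    using linear_minus_square_le[of "sqrt \<alpha>" y w] assms by simp
  moreover have "0 \<le> \<alpha> * y\<^sup>2" using assms by simp
  moreover have "tail_const * (2 * y\<^sup>2 - 1) \<le> tail_const * y ^ 4"
    using tail_const_pos quartic_ge_quadratic[of y] by (intro mult_left_mono) auto
  moreover have "tail_const * y ^ 4 \<le> 1 / 12 * y ^ 4"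
    using tail_const_le by (intro mult_right_mono) auto
  moreover have "0 \<le> tail_const * y\<^sup>2" using tail_const_pos by simp
  ultimately show ?thesis by (simp add: right_diff_distrib)
qed

lemma integrable_limit_integrand:
  assumes "0 \<le> \<alpha>"
  shows "integrable lborel (\<lambda>y. exp (sqrt \<alpha> * y * w - \<alpha> * y\<^sup>2 / 2 - y ^ 4 / 12))"
  by (rule Bochner_Integration.integrable_bound[OF integrable_gaussian_bound[of "w\<^sup>2 + tail_const"]])
     (use limit_exponent_le[OF assms] in auto)

lemma limit_integral_pos: "0 \<le> \<alpha> \<Longrightarrow> 0 < limit_integral \<alpha> w"
  unfolding limit_integral_def by (intro integral_exp_pos integrable_limit_integrand)

lemma measurable_limit_integral [measurable]: "limit_integral \<alpha> \<in> borel_measurable borel"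
  unfolding limit_integral_def[abs_def] by measurable

lemma limit_integral_tendsto:
  assumes "0 \<le> \<alpha>" and w: "w \<longlonglongrightarrow> w\<^sub>0"
  shows "(\<lambda>n. limit_integral \<alpha> (w n)) \<longlonglongrightarrow> limit_integral \<alpha> w\<^sub>0"
proof -
  from w have "Bseq w" by (intro convergent_imp_Bseq convergentI)
  then obtain B where B: "\<And>n. \<bar>w n\<bar> \<le> B" by (auto simp: Bseq_def)
  show ?thesis
    unfolding limit_integral_def
  proof (rule integral_dominated_convergence)
    show "AE y in lborel. (\<lambda>n. exp (sqrt \<alpha> * y * w n - \<alpha> * y\<^sup>2 / 2 - y ^ 4 / 12))
        \<longlonglongrightarrow> exp (sqrt \<alpha> * y * w\<^sub>0 - \<alpha> * y\<^sup>2 / 2 - y ^ 4 / 12)"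
      by (intro AE_I2 tendsto_intros w)
    show "AE y in lborel. norm (exp (sqrt \<alpha> * y * w n - \<alpha> * y\<^sup>2 / 2 - y ^ 4 / 12))
        \<le> exp (B\<^sup>2 + tail_const - tail_const * y\<^sup>2)" for n
    proof (rule AE_I2)
      fix y
      have "(w n)\<^sup>2 \<le> B\<^sup>2"
        using B[of n] by (metis abs_ge_zero power2_abs power_mono)
      then show "norm (exp (sqrt \<alpha> * y * w n - \<alpha> * y\<^sup>2 / 2 - y ^ 4 / 12))
          \<le> exp (B\<^sup>2 + tail_const - tail_const * y\<^sup>2)"
        using limit_exponent_le[OF assms(1), of y "w n"] by simp
    qed
    show "integrable lborel (\<lambda>y. exp (B\<^sup>2 + tail_const - tail_const * y\<^sup>2))"
      by (rule integrable_gaussian_bound)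
  qed auto
qed

definition limit_ratio :: "real \<Rightarrow> real \<Rightarrow> real" where
  "limit_ratio \<alpha> w = limit_integral \<alpha> w / limit_integral 0 0"

lemma measurable_limit_ratio [measurable]: "limit_ratio \<alpha> \<in> borel_measurable borel"
  unfolding limit_ratio_def[abs_def] by measurable

lemma limit_ratio_pos: "0 \<le> \<alpha> \<Longrightarrow> 0 < limit_ratio \<alpha> w"
  by (simp add: limit_ratio_def limit_integral_pos)

lemma isCont_limit_ratio: "0 \<le> \<alpha> \<Longrightarrow> isCont (limit_ratio \<alpha>) w"
  unfolding continuous_at_sequentially limit_ratio_def[abs_def] comp_def
  using limit_integral_pos[of 0 0] by (auto intro!: tendsto_divide limit_integral_tendsto)

text \<open>
  At \<open>w = 0\<close> the linear term vanishes and the integrand is strictly smaller than for \<open>\<alpha> = 0\<close> at every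
  \<open>y \<noteq> 0\<close>.
\<close>

lemma limit_ratio_0_less_1:
  assumes "0 < \<alpha>"
  shows "limit_ratio \<alpha> 0 < 1"
proof -
  have "limit_integral \<alpha> 0 < limit_integral 0 0"
  proof -
    let ?f = "\<lambda>\<alpha> y::real. exp (sqrt \<alpha> * y * 0 - \<alpha> * y\<^sup>2 / 2 - y ^ 4 / 12) :: real"
    have int: "integrable lborel (?f \<alpha>)" "integrable lborel (?f 0)"
      using integrable_limit_integrand[of \<alpha> 0] integrable_limit_integrand[of 0 0] assms by auto
    have "(\<integral>y. ?f 0 y - ?f \<alpha> y \<partial>lborel) \<noteq> 0"
    proof
      assume "(\<integral>y. ?f 0 y - ?f \<alpha> y \<partial>lborel) = 0"
      then have "AE y in lborel. ?f 0 y - ?f \<alpha> y = 0"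
        using int assms by (subst (asm) integral_nonneg_eq_0_iff_AE) auto
      then have "AE y in (lborel :: real measure). False"
        using AE_lborel_singleton[of "0::real"]
        by eventually_elim (use assms in auto)
      then show False by (auto simp: eventually_False ae_filter_eq_bot_iff)
    qed
    moreover have "0 \<le> (\<integral>y. ?f 0 y - ?f \<alpha> y \<partial>lborel)"
      using assms by (intro Bochner_Integration.integral_nonneg) auto
    ultimately have "0 < (\<integral>y. ?f 0 y - ?f \<alpha> y \<partial>lborel)" by linarith
    then show ?thesis
      using int unfolding limit_integral_def by (subst (asm) Bochner_Integration.integral_diff) auto
  qed
  then show ?thesis
    using limit_integral_pos[of 0 0] by (simp add: limit_ratio_def)
qed

text \<open>
  The substitution \<open>y = 2 * x\<close>, \<open>w = 2 * v\<close> passes from the unit variance of the normalized spin sum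
  to variance \<open>1 / 4\<close>; it turns \<open>y ^ 4 / 12\<close> into \<open>4 / 3 * x ^ 4\<close>.
\<close>

lemma limit_integral_rescale:
  "limit_integral \<alpha> (2 * v)
    = 2 * (\<integral>x. exp (4 * sqrt \<alpha> * x * v - 2 * \<alpha> * x\<^sup>2 - 4 / 3 * x ^ 4) \<partial>lborel)"
  unfolding limit_integral_def
  by (subst lborel_integral_real_affine[where c=2 and t=0]) (simp_all add: power_mult_distrib algebra_simps)

lemma quartic_density_eq:
  "quartic_density x = 2 * exp (- (4 / 3) * x ^ 4) / limit_integral 0 0"
  using limit_integral_rescale[of 0 0] by (simp add: quartic_density_def)

text \<open>
  Completing the square: \<open>- 2 * (v - sqrt \<alpha> * x)\<^sup>2\<close> splits into \<open>- 2 * v\<^sup>2\<close>, which is the exponent of the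
  centred Gaussian, and the tilt that occurs in \<open>limit_integral_rescale\<close>.
\<close>

lemma quartic_gaussian_convolution:
  assumes "0 \<le> \<alpha>"
  shows "(\<integral>\<^sup>+x. ennreal (quartic_density x) * ennreal (normal_density 0 (1 / 2) (v - sqrt \<alpha> * x)) \<partial>lborel)
    = ennreal (normal_density 0 (1 / 2) v) * ennreal (limit_ratio \<alpha> (2 * v))"
proof -
  let ?e = "\<lambda>x. exp (4 * sqrt \<alpha> * x * v - 2 * \<alpha> * x\<^sup>2 - 4 / 3 * x ^ 4)"
  let ?c = "2 * normal_density 0 (1 / 2) v / limit_integral 0 0"
  have J: "0 < limit_integral 0 0" by (rule limit_integral_pos) simp
  have c: "0 \<le> ?c" using J by simp
  have int: "integrable lborel ?e"
  proof -
    have "integrable lborel (\<lambda>x. exp (sqrt \<alpha> * (0 + 2 * x) * (2 * v) - \<alpha> * (0 + 2 * x)\<^sup>2 / 2 - (0 + 2 * x) ^ 4 / 12))"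
      using integrable_limit_integrand[OF assms, of "2 * v"]
      by (intro lborel_integrable_real_affine) auto
    then show ?thesis by (simp add: power_mult_distrib algebra_simps)
  qed
  have eq: "quartic_density x * normal_density 0 (1 / 2) (v - sqrt \<alpha> * x) = ?c * ?e x" for x
  proof -
    have "- 2 * (v - sqrt \<alpha> * x)\<^sup>2 = - 2 * v\<^sup>2 + (4 * sqrt \<alpha> * x * v - 2 * \<alpha> * x\<^sup>2)"
      using assms by (simp add: power2_diff power_mult_distrib algebra_simps)
    then have "exp (- 2 * (v - sqrt \<alpha> * x)\<^sup>2) * exp (- (4 / 3) * x ^ 4) = exp (- 2 * v\<^sup>2) * ?e x"
      by (simp flip: exp_add)
    then show ?thesis
      by (simp add: quartic_density_eq normal_density_def power_divide mult_ac)
  qed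
  have "(\<integral>\<^sup>+x. ennreal (quartic_density x) * ennreal (normal_density 0 (1 / 2) (v - sqrt \<alpha> * x)) \<partial>lborel)
      = (\<integral>\<^sup>+x. ennreal (?c * ?e x) \<partial>lborel)"
    unfolding eq[symmetric]
    using J by (intro nn_integral_cong ennreal_mult[symmetric]) (auto simp: quartic_density_eq)
  also have "\<dots> = ennreal (\<integral>x. ?c * ?e x \<partial>lborel)"
    using int c by (intro nn_integral_eq_integral integrable_mult_right AE_I2 mult_nonneg_nonneg) auto
  also have "(\<integral>x. ?c * ?e x \<partial>lborel) = normal_density 0 (1 / 2) v * limit_ratio \<alpha> (2 * v)"
    by (simp add: limit_ratio_def limit_integral_rescale)
  finally show ?thesis
    using limit_ratio_pos[OF assms, of "2 * v"] by (simp add: ennreal_mult less_imp_le)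
qed

lemma normal_law_quarter: "normal_law 0 (1 / 4) = density lborel (\<lambda>x. ennreal (normal_density 0 (1 / 2) x))"
  by (simp add: normal_law_def real_sqrt_divide)

lemma sets_normal_law [measurable_cong, simp]: "sets (normal_law m v) = sets borel"
  by (simp add: normal_law_def)

lemma sets_quartic_law [measurable_cong, simp]: "sets quartic_law = sets borel"
  by (simp add: quartic_law_def)

lemma prob_space_normal_law: "prob_space (normal_law 0 (1 / 4))"
  unfolding normal_law_quarter by (rule prob_space_normal_density) simp

lemma measurable_quartic_density [measurable]: "quartic_density \<in> borel_measurable borel"
  unfolding quartic_density_def[abs_def] by measurable

lemma prob_space_quartic_law: "prob_space quartic_law"
proof
  let ?e = "\<lambda>x::real. exp (- (4 / 3) * x ^ 4)"
  have J: "0 < limit_integral 0 0" by (rule limit_integral_pos) simp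
  have "integrable lborel (\<lambda>x::real. exp (sqrt 0 * (0 + 2 * x) * 0 - 0 * (0 + 2 * x)\<^sup>2 / 2 - (0 + 2 * x) ^ 4 / 12))"
    using integrable_limit_integrand[of 0 0]
    by (intro lborel_integrable_real_affine) auto
  then have int: "integrable lborel ?e" by (simp add: power_mult_distrib)
  have "emeasure quartic_law (space quartic_law) = (\<integral>\<^sup>+x. ennreal (quartic_density x) \<partial>lborel)"
    unfolding quartic_law_def by (simp add: emeasure_density)
  also have "\<dots> = ennreal (\<integral>x. quartic_density x \<partial>lborel)"
    using int J unfolding quartic_density_eq[abs_def] by (intro nn_integral_eq_integral) auto
  also have "(\<integral>x. quartic_density x \<partial>lborel) = 1"
    using limit_integral_rescale[of 0 0] J by (simp add: quartic_density_eq)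
  finally show "emeasure quartic_law (space quartic_law) = 1" by simp
qed

lemma nu_eq_density:
  assumes "0 \<le> \<alpha>"
  shows "nu \<alpha> = density (normal_law 0 (1 / 4)) (\<lambda>v. ennreal (limit_ratio \<alpha> (2 * v)))"
proof (rule measure_eqI)
  show "sets (nu \<alpha>) = sets (density (normal_law 0 (1 / 4)) (\<lambda>v. ennreal (limit_ratio \<alpha> (2 * v))))"
    by (simp add: nu_def)
  fix A assume "A \<in> sets (nu \<alpha>)"
  then have A [measurable]: "A \<in> sets borel" by (simp add: nu_def)
  let ?\<phi> = "normal_density 0 (1 / 2)"
  interpret N: prob_space "normal_law 0 (1 / 4)" by (rule prob_space_normal_law)
  interpret Q: prob_space quartic_law by (rule prob_space_quartic_law)
  interpret NQ: pair_sigma_finite "normal_law 0 (1 / 4)" quartic_law ..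
  have "emeasure (nu \<alpha>) A
      = (\<integral>\<^sup>+p. indicator A (fst p + sqrt \<alpha> * snd p) \<partial>(normal_law 0 (1 / 4) \<Otimes>\<^sub>M quartic_law))"
    unfolding nu_def
    by (subst nn_integral_indicator[symmetric], simp, subst nn_integral_distr) (auto simp: split_beta')
  also have "\<dots> = (\<integral>\<^sup>+x. \<integral>\<^sup>+z. indicator A (z + sqrt \<alpha> * x) \<partial>normal_law 0 (1 / 4) \<partial>quartic_law)"
    by (subst NQ.nn_integral_snd[symmetric]) auto
  also have "\<dots> = (\<integral>\<^sup>+x. ennreal (quartic_density x)
      * (\<integral>\<^sup>+z. ennreal (?\<phi> z) * indicator A (z + sqrt \<alpha> * x) \<partial>lborel) \<partial>lborel)"
    unfolding quartic_law_def normal_law_quarter by (simp add: nn_integral_density)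
  also have "\<dots> = (\<integral>\<^sup>+x. ennreal (quartic_density x)
      * (\<integral>\<^sup>+v. ennreal (?\<phi> (v - sqrt \<alpha> * x)) * indicator A v \<partial>lborel) \<partial>lborel)"
  proof (rule nn_integral_cong, rule arg_cong2[where f="(*)", OF refl])
    fix x
    show "(\<integral>\<^sup>+z. ennreal (?\<phi> z) * indicator A (z + sqrt \<alpha> * x) \<partial>lborel)
        = (\<integral>\<^sup>+v. ennreal (?\<phi> (v - sqrt \<alpha> * x)) * indicator A v \<partial>lborel)"
      by (subst nn_integral_real_affine[where c=1 and t="- sqrt \<alpha> * x"]) (auto simp: algebra_simps)
  qed
  also have "\<dots> = (\<integral>\<^sup>+x. \<integral>\<^sup>+v. ennreal (quartic_density x) * ennreal (?\<phi> (v - sqrt \<alpha> * x))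
      * indicator A v \<partial>lborel \<partial>lborel)"
    by (simp add: nn_integral_cmult[symmetric] mult.assoc)
  also have "\<dots> = (\<integral>\<^sup>+v. \<integral>\<^sup>+x. ennreal (quartic_density x) * ennreal (?\<phi> (v - sqrt \<alpha> * x))
      * indicator A v \<partial>lborel \<partial>lborel)"
    by (rule lborel_pair.Fubini') measurable
  also have "\<dots> = (\<integral>\<^sup>+v. ennreal (?\<phi> v) * (ennreal (limit_ratio \<alpha> (2 * v)) * indicator A v) \<partial>lborel)"
  proof (rule nn_integral_cong)
    fix v
    show "(\<integral>\<^sup>+x. ennreal (quartic_density x) * ennreal (?\<phi> (v - sqrt \<alpha> * x)) * indicator A v \<partial>lborel)
        = ennreal (?\<phi> v) * (ennreal (limit_ratio \<alpha> (2 * v)) * indicator A v)"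
      by (subst nn_integral_multc) (simp_all only: quartic_gaussian_convolution[OF assms] mult.assoc, measurable)
  qed
  also have "\<dots> = emeasure (density (normal_law 0 (1 / 4)) (\<lambda>v. ennreal (limit_ratio \<alpha> (2 * v)))) A"
    unfolding normal_law_quarter by (simp add: emeasure_density nn_integral_density)
  finally show "emeasure (nu \<alpha>) A
      = emeasure (density (normal_law 0 (1 / 4)) (\<lambda>v. ennreal (limit_ratio \<alpha> (2 * v)))) A" .
qed

lemma prob_space_nu: "prob_space (nu \<alpha>)"
proof -
  interpret N: prob_space "normal_law 0 (1 / 4)" by (rule prob_space_normal_law)
  interpret Q: prob_space quartic_law by (rule prob_space_quartic_law)
  interpret NQ: pair_prob_space "normal_law 0 (1 / 4)" quartic_law ..
  show ?thesis
    unfolding nu_def by (rule NQ.prob_space_distr) measurable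
qed

text \<open>
  The same functional as in \<open>tv_dist_cw_marginal_tendsto\<close>, with \<open>L = limit_ratio \<alpha>\<close>.
\<close>

lemma tv_dist_nu:
  assumes "0 \<le> \<alpha>"
  shows "tv_dist (nu \<alpha>) (normal_law 0 (1 / 4))
    = (\<integral>w. max 0 (1 - limit_ratio \<alpha> w) \<partial>std_normal_distribution)"
proof -
  have "tv_dist (nu \<alpha>) (normal_law 0 (1 / 4))
      = (\<integral>v. max 0 (1 - limit_ratio \<alpha> (2 * v)) \<partial>normal_law 0 (1 / 4))"
    unfolding nu_eq_density[OF assms]
  proof (rule tv_dist_density)
    show "prob_space (density (normal_law 0 (1 / 4)) (\<lambda>v. ennreal (limit_ratio \<alpha> (2 * v))))"
      using prob_space_nu[of \<alpha>] unfolding nu_eq_density[OF assms] .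
    show "(\<lambda>v. limit_ratio \<alpha> (2 * v)) \<in> borel_measurable (normal_law 0 (1 / 4))"
      by (subst measurable_cong_sets[OF sets_normal_law refl]) measurable
  qed (auto simp: prob_space_normal_law less_imp_le[OF limit_ratio_pos[OF assms]])
  also have "\<dots> = (\<integral>v. normal_density 0 (1 / 2) v * max 0 (1 - limit_ratio \<alpha> (2 * v)) \<partial>lborel)"
    unfolding normal_law_quarter by (subst integral_density) auto
  also have "\<dots> = (\<integral>w. std_normal_density w * max 0 (1 - limit_ratio \<alpha> w) \<partial>lborel)"
  proof -
    have "normal_density 0 (1 / 2) (0 + 1 / 2 * w) = 2 * std_normal_density w" for w :: real
      by (simp add: normal_density_def power_divide real_sqrt_divide real_sqrt_mult field_simps)
    moreover have "2 * (0 + 1 / 2 * w) = w" for w :: real by simp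
    ultimately show ?thesis
      by (subst lborel_integral_real_affine[where c="1 / 2" and t=0]) (simp_all only: mult.assoc, simp_all)
  qed
  also have "\<dots> = (\<integral>w. max 0 (1 - limit_ratio \<alpha> w) \<partial>std_normal_distribution)"
    by (subst integral_density) auto
  finally show ?thesis .
qed

text \<open>
  The density is continuous and lies below 1 at the origin, hence on an interval, which makes the distance
  positive. It is nowhere 0, so the positive part of one minus the density is strictly below 1.
\<close>

lemma tv_dist_nu_bounds:
  assumes "0 < \<alpha>"
  shows "0 < tv_dist (nu \<alpha>) (normal_law 0 (1 / 4))" and "tv_dist (nu \<alpha>) (normal_law 0 (1 / 4)) < 1"
proof -
  interpret real_distribution std_normal_distribution by (rule real_dist_normal_dist)
  let ?h = "\<lambda>w. max 0 (1 - limit_ratio \<alpha> w)"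
  have pos: "0 < limit_ratio \<alpha> w" for w
    using assms by (intro limit_ratio_pos) simp
  have h: "0 \<le> ?h w" "?h w < 1" for w
    using pos[of w] by (auto simp: max_def)
  have int: "integrable std_normal_distribution ?h"
    by (rule integrable_const_bound[where B=1]) (use h in \<open>auto simp: less_imp_le\<close>)
  have tv: "tv_dist (nu \<alpha>) (normal_law 0 (1 / 4)) = expectation ?h"
    using assms by (intro tv_dist_nu) simp
  show "tv_dist (nu \<alpha>) (normal_law 0 (1 / 4)) < 1"
    unfolding tv using int h(2) by (intro expectation_less) auto
  have "expectation ?h \<noteq> 0"
  proof
    assume "expectation ?h = 0"
    then have "AE w in std_normal_distribution. ?h w = 0"
      using int h(1) by (subst (asm) integral_nonneg_eq_0_iff_AE) auto
    then have AE: "AE w in lborel. ?h w = 0"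
      by (subst (asm) AE_density) (auto simp: normal_density_pos)
    have "\<forall>\<^sub>F w in at 0. limit_ratio \<alpha> w < 1"
      using isCont_limit_ratio[of \<alpha> 0] assms unfolding isCont_def
      by (intro order_tendstoD(2)[OF _ limit_ratio_0_less_1[OF assms]]) simp
    then obtain d where d: "0 < d" "\<And>w. w \<noteq> 0 \<Longrightarrow> dist w 0 < d \<Longrightarrow> limit_ratio \<alpha> w < 1"
      unfolding eventually_at by auto
    from AE have "AE w in lborel. w \<notin> {0<..<d}"
    proof eventually_elim
      case (elim w)
      then have "1 \<le> limit_ratio \<alpha> w" by (simp add: max_def split: if_splits)
      then show ?case using d(2)[of w] by (auto simp: dist_real_def)
    qed
    then have "{0<..<d} \<in> null_sets lborel"
      by (subst AE_iff_null_sets) auto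
    then show False using d(1) by (simp add: null_sets_def)
  qed
  moreover have "0 \<le> expectation ?h" by (rule Bochner_Integration.integral_nonneg) (rule h)
  ultimately show "0 < tv_dist (nu \<alpha>) (normal_law 0 (1 / 4))"
    unfolding tv by linarith
qed

section \<open>The three regimes\<close>

lemma field_ratio_denominator_tendsto: "(\<lambda>N. field_integral N 0 0) \<longlonglongrightarrow> limit_integral 0 0"
  by (rule field_integral_tendsto_limit_integral) auto

lemma field_ratio_tendsto_limit_ratio:
  assumes k: "\<And>N. N \<ge> 1 \<Longrightarrow> k N \<le> N"
    and ratio: "(\<lambda>N. real (k N) / sqrt (real N)) \<longlonglongrightarrow> \<alpha>"
    and w: "w \<longlonglongrightarrow> w\<^sub>0"
  shows "(\<lambda>N. field_ratio N (k N) (w N)) \<longlonglongrightarrow> limit_ratio \<alpha> w\<^sub>0"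
  unfolding field_ratio_def limit_ratio_def
  using field_integral_tendsto_limit_integral[OF assms] field_ratio_denominator_tendsto
    limit_integral_pos[of 0 0]
  by (intro tendsto_divide) auto

lemma field_ratio_tendsto_0:
  assumes k: "\<And>N. N \<ge> 1 \<Longrightarrow> k N \<le> N"
    and ratio: "filterlim (\<lambda>N. real (k N) / sqrt (real N)) at_top sequentially"
    and w: "w \<longlonglongrightarrow> w\<^sub>0"
  shows "(\<lambda>N. field_ratio N (k N) (w N)) \<longlonglongrightarrow> 0"
  using tendsto_divide[OF field_integral_tendsto_0[OF assms] field_ratio_denominator_tendsto]
    limit_integral_pos[of 0 0]
  by (simp add: field_ratio_def)

theorem theorem1p1:
  fixes k :: "nat \<Rightarrow> nat"
  assumes k_range: "\<And>N. N \<ge> 1 \<Longrightarrow> 1 \<le> k N \<and> k N \<le> N"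
    and k_lim: "filterlim k at_top sequentially"
  shows "((\<lambda>N. real (k N) / sqrt (real N)) \<longlonglongrightarrow> 0 \<longrightarrow>
            (\<lambda>N. tv_dist (cw_marginal N (k N)) (fair_spins (k N))) \<longlonglongrightarrow> 0)
       \<and> (\<forall>\<alpha>>0. (\<lambda>N. real (k N) / sqrt (real N)) \<longlonglongrightarrow> \<alpha> \<longrightarrow>
            (\<lambda>N. tv_dist (cw_marginal N (k N)) (fair_spins (k N)))
              \<longlonglongrightarrow> tv_dist (nu \<alpha>) (normal_law 0 (1 / 4))
            \<and> 0 < tv_dist (nu \<alpha>) (normal_law 0 (1 / 4))
            \<and> tv_dist (nu \<alpha>) (normal_law 0 (1 / 4)) < 1)
       \<and> (filterlim (\<lambda>N. real (k N) / sqrt (real N)) at_top sequentially \<longrightarrow>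
            (\<lambda>N. tv_dist (cw_marginal N (k N)) (fair_spins (k N))) \<longlonglongrightarrow> 1)"
proof (intro conjI impI allI)
  have k_le: "N \<ge> 1 \<Longrightarrow> k N \<le> N" for N
    using k_range by simp
  have limit: "(\<lambda>N. tv_dist (cw_marginal N (k N)) (fair_spins (k N)))
      \<longlonglongrightarrow> (\<integral>w. max 0 (1 - limit_ratio \<alpha> w) \<partial>std_normal_distribution)"
    if "(\<lambda>N. real (k N) / sqrt (real N)) \<longlonglongrightarrow> \<alpha>" for \<alpha>
    by (rule tv_dist_cw_marginal_tendsto[OF k_le k_lim])
       (auto intro: field_ratio_tendsto_limit_ratio[OF k_le that])
  {
    assume "(\<lambda>N. real (k N) / sqrt (real N)) \<longlonglongrightarrow> 0"
    moreover have "limit_ratio 0 w = 1" for w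
      using limit_integral_pos[of 0 0] by (simp add: limit_ratio_def limit_integral_def)
    ultimately show "(\<lambda>N. tv_dist (cw_marginal N (k N)) (fair_spins (k N))) \<longlonglongrightarrow> 0"
      using limit[of 0] by simp
  next
    fix \<alpha> :: real
    assume "0 < \<alpha>" and "(\<lambda>N. real (k N) / sqrt (real N)) \<longlonglongrightarrow> \<alpha>"
    then show "(\<lambda>N. tv_dist (cw_marginal N (k N)) (fair_spins (k N)))
        \<longlonglongrightarrow> tv_dist (nu \<alpha>) (normal_law 0 (1 / 4))"
      using limit[of \<alpha>] by (simp add: tv_dist_nu)
    show "0 < tv_dist (nu \<alpha>) (normal_law 0 (1 / 4))" "tv_dist (nu \<alpha>) (normal_law 0 (1 / 4)) < 1"
      using \<open>0 < \<alpha>\<close> by (rule tv_dist_nu_bounds)+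
  next
    assume ratio: "filterlim (\<lambda>N. real (k N) / sqrt (real N)) at_top sequentially"
    interpret real_distribution std_normal_distribution by (rule real_dist_normal_dist)
    have "(\<lambda>N. tv_dist (cw_marginal N (k N)) (fair_spins (k N)))
        \<longlonglongrightarrow> (\<integral>w. max 0 (1 - 0) \<partial>std_normal_distribution)"
      by (rule tv_dist_cw_marginal_tendsto[OF k_le k_lim])
         (auto intro: field_ratio_tendsto_0[OF k_le ratio])
    then show "(\<lambda>N. tv_dist (cw_marginal N (k N)) (fair_spins (k N))) \<longlonglongrightarrow> 1"
      using prob_space by simp
  }
qed

end
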